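(* Let $\varphi_X\colon A\to X$ and $\varphi_Y\colon A\to Y$ be maps of directed graphs, let $X\cup_AY$ be their pushout in the category of directed graphs, and let $j_X\colon X\to X\cup_AY$ and $j_Y\colon Y\to X\cup_AY$ denote the canonical maps. If $\varphi_X$ is an $r$-cofibration for $r\ge 2$ and $A,X,Y$ are connected, then for $r\le s<\infty$, the sequence $$E_{1,0}^s(A)\xrightarrow{((\varphi_X)_*,(\varphi_Y)_* )}E_{1,0}^s(X)\oplus E_{1,0}^s(Y)\xrightarrow{(j_X)_*-(j_Y)_*}E_{1,0}^s(X\cup_AY)\to 0$$ is exact.
   Context: A directed graph $X$ consists of a vertex set $V(X)$ and an edge set $E(X)\subset V(X)\times V(X)-\Delta$, where $\Delta$ is the diagonal. A map $f\colon X\to Y$ is a function $V(X)\to V(Y)$ such that for every $(x,y)\in E(X)$ either $(f(x),f(y))\in E(Y)$ or $f(x)=f(y)$; directed graphs and maps form the category of directed graphs. The induced subgraph of $X$ on $W\subset V(X)$ has vertex set $W$ and all edges of $X$ between elements of $W$. A directed graph is connected if any two vertices are connected by a zig-zag of finitely many edges. For vertices $x,y$ of $X$, $d(x,y)$ is the minimal length $n$ of a sequence $x=x_0,\ldots,x_n=y$ with $(x_i,x_{i+1})\in E(X)$ ($\infty$ if none), and $L(x_0,\ldots,x_n)=\sum_{i=0}^{n-1}d(x_i,x_{i+1})$. $\mathrm{RC}_n(X)$ is the free abelian group on tuples $(x_0,\ldots,x_n)\in V(X)^{n+1}$ with $L(x_0,\ldots,x_n)<\infty$ and $x_i\ne x_{i+1}$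 for all $i$, with $\partial(x_0,\ldots,x_n)=\sum_{i=0}^n(-1)^i(x_0,\ldots,\widehat{x_i},\ldots,x_n)$, where tuples with two equal consecutive entries are set to $0$. $F_p\mathrm{RC}_*(X)$ is the subcomplex spanned by generators with $L\le p$. The magnitude-path spectral sequence $E^r_{p,q}(X)$ is the homology spectral sequence of this filtration (standard indexing, $p$ filtration degree, $p+q$ total degree, $d^r$ of bidegree $(-r,r-1)$): $E^r_{p,q}=Z^r_{p,q}/(Z^{r-1}_{p-1,q+1}+\partial Z^{r-1}_{p+r-1,q-r+2})$ with $Z^r_{p,q}=\{c\in F_p\mathrm{RC}_{p+q}(X)\mid\partial c\in F_{p-r}\mathrm{RC}_{p+q-1}(X)\}$. It is functorial for maps. For a subgraph $A$ of $X$, the reach $\mathrm{r}(A)$ is the set of all vertices $x$ of $X$ with $d(a,x)<\infty$ for some $a\in V(A)$. For $1\le r<\infty$, an $r$-cofibration is an induced subgraph inclusion $A\to X$ such that (with $d$ taken in $X$) (1) $d(x,a)=\infty$ for any $x\in V(X)-V(A)$ and $a\in V(A)$; and (2) there is a function $\pi\colon\mathrm{r}(A)\to V(A)$ such that for any $a\in V(A)$ and $x\in\mathrm{r}(A)$: $d(a,\pi(x))\le d(a,x)$; $d(a,\pi(x))+d(\pi(x),x)\le r$ if $d(a,x)\le r$; and $d(a,\pi(x))+d(\pi(x),x)=d(a,x)$ if $d(a,x)>r$. *)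

theory Defs
  imports
    "Graph_Theory.Pair_Digraph"
    "HOL-Algebra.Elementary_Groups"
    "HOL-Algebra.Free_Abelian_Groups"
    "HOL-Library.Extended_Nat"
begin

section \<open>Directed graphs\<close>

text \<open>
  A directed graph is a \<^typ>\<open>'a pair_pre_digraph\<close> \<open>X\<close> satisfying
  \<^term>\<open>pair_loopfree_digraph X\<close>, that is, \<open>E(X) \<subseteq> V(X) \<times> V(X) - \<Delta>\<close>. No finiteness is assumed.
\<close>

definition digraph_map :: "'a pair_pre_digraph \<Rightarrow> 'b pair_pre_digraph \<Rightarrow> ('a \<Rightarrow> 'b) \<Rightarrow> bool" where
  "digraph_map X Y f \<longleftrightarrow>
     f ` pverts X \<subseteq> pverts Y \<and>
     (\<forall>(x, y) \<in> parcs X. (f x, f y) \<in> parcs Y \<or> f x = f y)"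

text \<open>
  Unlike the predicate \<open>connected\<close> of the \<open>Graph_Theory\<close> entry, this notion does not exclude
  the empty graph.
\<close>

definition zigzag_connected :: "'a pair_pre_digraph \<Rightarrow> bool" where
  "zigzag_connected X \<longleftrightarrow>
     (\<forall>x \<in> pverts X. \<forall>y \<in> pverts X. (x, y) \<in> (parcs X \<union> (parcs X)\<inverse>)\<^sup>*)"

definition ddist :: "'a pair_pre_digraph \<Rightarrow> 'a \<Rightarrow> 'a \<Rightarrow> enat" where
  "ddist X x y = (INF n \<in> {n. (x, y) \<in> parcs X ^^ n}. enat n)"

section \<open>Cofibrations\<close>

definition reach :: "'a pair_pre_digraph \<Rightarrow> 'a set \<Rightarrow> 'a set" where
  "reach X W = {x \<in> pverts X. \<exists>a \<in> W. ddist X a x < \<infinity>}"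

text \<open>
  \<open>i\<close> is an isomorphism from \<open>A\<close> onto the induced subgraph of \<open>X\<close> on \<open>i(V(A))\<close>; for \<open>i = id\<close> this
  says that \<open>A\<close> is literally an induced subgraph of \<open>X\<close>.
\<close>

definition induced_inclusion :: "'a pair_pre_digraph \<Rightarrow> 'b pair_pre_digraph \<Rightarrow> ('a \<Rightarrow> 'b) \<Rightarrow> bool" where
  "induced_inclusion A X i \<longleftrightarrow>
     i ` pverts A \<subseteq> pverts X \<and> inj_on i (pverts A) \<and>
     (\<forall>a \<in> pverts A. \<forall>b \<in> pverts A. (a, b) \<in> parcs A \<longleftrightarrow> (i a, i b) \<in> parcs X)"

definition r_cofibration :: "nat \<Rightarrow> 'a pair_pre_digraph \<Rightarrow> 'b pair_pre_digraph \<Rightarrow> ('a \<Rightarrow> 'b) \<Rightarrow> bool" where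
  "r_cofibration r A X i \<longleftrightarrow>
     induced_inclusion A X i \<and>
     (\<forall>x \<in> pverts X - i ` pverts A. \<forall>a \<in> i ` pverts A. ddist X x a = \<infinity>) \<and>
     (\<exists>\<pi>. \<pi> ` reach X (i ` pverts A) \<subseteq> i ` pverts A \<and>
        (\<forall>a \<in> i ` pverts A. \<forall>x \<in> reach X (i ` pverts A).
           ddist X a (\<pi> x) \<le> ddist X a x \<and>
           (ddist X a x \<le> enat r \<longrightarrow> ddist X a (\<pi> x) + ddist X (\<pi> x) x \<le> enat r) \<and>
           (ddist X a x > enat r \<longrightarrow> ddist X a (\<pi> x) + ddist X (\<pi> x) x = ddist X a x)))"

section \<open>Pushouts\<close>

text \<open>
  The pushout of \<open>X \<leftarrow> A \<rightarrow> Y\<close> is the quotient of the disjoint union by the equivalence relation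
  generated by \<open>f(a) \<sim> g(a)\<close>, with the images of all edges that do not become loops. Its universal
  property is \<open>pushout_universal\<close> below.
\<close>

definition pushout_rel ::
  "'a pair_pre_digraph \<Rightarrow> ('a \<Rightarrow> 'b) \<Rightarrow> ('a \<Rightarrow> 'c) \<Rightarrow> ('b + 'c) rel" where
  "pushout_rel A f g =
     (let R = {(Inl (f a), Inr (g a)) | a. a \<in> pverts A} in (R \<union> R\<inverse>)\<^sup>*)"

definition pushout_inl ::
  "'a pair_pre_digraph \<Rightarrow> ('a \<Rightarrow> 'b) \<Rightarrow> ('a \<Rightarrow> 'c) \<Rightarrow> 'b \<Rightarrow> ('b + 'c) set" where
  "pushout_inl A f g x = pushout_rel A f g `` {Inl x}"

definition pushout_inr ::
  "'a pair_pre_digraph \<Rightarrow> ('a \<Rightarrow> 'b) \<Rightarrow> ('a \<Rightarrow> 'c) \<Rightarrow> 'c \<Rightarrow> ('b + 'c) set" where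
  "pushout_inr A f g y = pushout_rel A f g `` {Inr y}"

definition pushout ::
  "'a pair_pre_digraph \<Rightarrow> 'b pair_pre_digraph \<Rightarrow> 'c pair_pre_digraph \<Rightarrow>
   ('a \<Rightarrow> 'b) \<Rightarrow> ('a \<Rightarrow> 'c) \<Rightarrow> ('b + 'c) set pair_pre_digraph" where
  "pushout A X Y f g =
     \<lparr> pverts = (pverts X <+> pverts Y) // pushout_rel A f g,
       parcs = (map_prod (pushout_inl A f g) (pushout_inl A f g) ` parcs X \<union>
                map_prod (pushout_inr A f g) (pushout_inr A f g) ` parcs Y) - Id \<rparr>"

lemma equiv_pushout_rel: "equiv UNIV (pushout_rel A f g)"
  unfolding pushout_rel_def Let_def
  by (intro equivI sym_rtrancl trans_rtrancl refl_rtrancl) (auto simp: sym_def)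

lemma pushout_rel_glue: "a \<in> pverts A \<Longrightarrow> (Inl (f a), Inr (g a)) \<in> pushout_rel A f g"
  unfolding pushout_rel_def Let_def by (rule r_into_rtrancl) auto

lemma pushout_rel_invariant:
  assumes "(u, v) \<in> pushout_rel A f g" and "\<And>a. a \<in> pverts A \<Longrightarrow> h (f a) = k (g a)"
  shows "case_sum h k u = case_sum h k v"
  using assms(1) unfolding pushout_rel_def Let_def
  by (induction rule: rtrancl_induct) (auto simp: assms(2))

lemma pverts_pushout:
  "pverts (pushout A X Y f g) = pushout_inl A f g ` pverts X \<union> pushout_inr A f g ` pverts Y"
  by (auto simp: pushout_def quotient_def pushout_inl_def pushout_inr_def)

lemma pushout_loopfree:
  assumes "pair_loopfree_digraph X" "pair_loopfree_digraph Y"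
  shows "pair_loopfree_digraph (pushout A X Y f g)"
proof -
  interpret X: pair_loopfree_digraph X by fact
  interpret Y: pair_loopfree_digraph Y by fact
  show ?thesis
    by unfold_locales
      (auto simp: pverts_pushout, auto simp: pushout_def dest: X.wellformed' Y.wellformed')
qed

lemma pushout_cocone:
  assumes "pair_loopfree_digraph X" "pair_loopfree_digraph Y"
  shows "digraph_map X (pushout A X Y f g) (pushout_inl A f g)"
    and "digraph_map Y (pushout A X Y f g) (pushout_inr A f g)"
    and "\<And>a. a \<in> pverts A \<Longrightarrow> pushout_inl A f g (f a) = pushout_inr A f g (g a)"
proof -
  show "digraph_map X (pushout A X Y f g) (pushout_inl A f g)"
    "digraph_map Y (pushout A X Y f g) (pushout_inr A f g)"
    unfolding digraph_map_def by (force simp: pverts_pushout pushout_def [THEN arg_cong [of _ _ parcs]])+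
  show "pushout_inl A f g (f a) = pushout_inr A f g (g a)" if "a \<in> pverts A" for a
    unfolding pushout_inl_def pushout_inr_def
    by (rule equiv_class_eq [OF equiv_pushout_rel pushout_rel_glue [OF that]])
qed

lemma pushout_universal:
  fixes T :: "'d pair_pre_digraph"
  assumes "pair_loopfree_digraph X" "pair_loopfree_digraph Y" "pair_loopfree_digraph T"
    and h: "digraph_map X T h" and k: "digraph_map Y T k"
    and comm: "\<And>a. a \<in> pverts A \<Longrightarrow> h (f a) = k (g a)"
  shows "\<exists>u. digraph_map (pushout A X Y f g) T u \<and>
           (\<forall>x \<in> pverts X. u (pushout_inl A f g x) = h x) \<and>
           (\<forall>y \<in> pverts Y. u (pushout_inr A f g y) = k y) \<and>
           (\<forall>v. digraph_map (pushout A X Y f g) T v \<and>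
                (\<forall>x \<in> pverts X. v (pushout_inl A f g x) = h x) \<and>
                (\<forall>y \<in> pverts Y. v (pushout_inr A f g y) = k y) \<longrightarrow>
                (\<forall>z \<in> pverts (pushout A X Y f g). v z = u z))"
proof -
  interpret X: pair_loopfree_digraph X by fact
  interpret Y: pair_loopfree_digraph Y by fact
  define u where "u C = case_sum h k (SOME w. w \<in> C)" for C
  have cls: "case_sum h k (SOME w'. w' \<in> pushout_rel A f g `` {w}) = case_sum h k w" for w
  proof -
    have "w \<in> pushout_rel A f g `` {w}"
      by (rule equiv_class_self [OF equiv_pushout_rel]) simp
    then have "(SOME w'. w' \<in> pushout_rel A f g `` {w}) \<in> pushout_rel A f g `` {w}"
      by (rule someI)
    then show ?thesis
      using pushout_rel_invariant [where h = h and k = k and f = f and g = g and A = A] comm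
      by (metis Image_singleton_iff)
  qed
  have ul: "u (pushout_inl A f g x) = h x" for x
    using cls [of "Inl x"] by (simp add: u_def pushout_inl_def)
  have ur: "u (pushout_inr A f g y) = k y" for y
    using cls [of "Inr y"] by (simp add: u_def pushout_inr_def)
  have "digraph_map (pushout A X Y f g) T u"
    unfolding digraph_map_def
  proof (intro conjI)
    show "u ` pverts (pushout A X Y f g) \<subseteq> pverts T"
      using h k by (auto simp: pverts_pushout ul ur digraph_map_def)
    show "\<forall>(x, y) \<in> parcs (pushout A X Y f g). (u x, u y) \<in> parcs T \<or> u x = u y"
      using h k by (fastforce simp: pushout_def ul ur digraph_map_def)
  qed
  then show ?thesis
    using ul ur by (intro exI [of _ u]) (auto simp: pverts_pushout)
qed

section \<open>The reachability complex\<close>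

definition tuple_length :: "'a pair_pre_digraph \<Rightarrow> 'a list \<Rightarrow> enat" where
  "tuple_length X xs = (\<Sum>i < length xs - 1. ddist X (xs ! i) (xs ! Suc i))"

text \<open>
  The tuple \<open>(x\<^sub>0, \<dots>, x\<^sub>n)\<close> is the list of length \<open>n + 1\<close>. Degrees and filtration indices are
  integers; the groups in negative degree or filtration are zero.
\<close>

definition rc_tuples :: "'a pair_pre_digraph \<Rightarrow> int \<Rightarrow> 'a list set" where
  "rc_tuples X n =
     {xs. xs \<noteq> [] \<and> int (length xs) = n + 1 \<and> set xs \<subseteq> pverts X \<and>
          tuple_length X xs < \<infinity> \<and> distinct_adj xs}"

definition rc_group :: "'a pair_pre_digraph \<Rightarrow> int \<Rightarrow> ('a list \<Rightarrow>\<^sub>0 int) monoid" where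
  "rc_group X n = free_Abelian_group (rc_tuples X n)"

definition rc_filtration :: "'a pair_pre_digraph \<Rightarrow> int \<Rightarrow> int \<Rightarrow> ('a list \<Rightarrow>\<^sub>0 int) set" where
  "rc_filtration X p n =
     carrier (free_Abelian_group
       {xs \<in> rc_tuples X n. \<exists>m. tuple_length X xs = enat m \<and> int m \<le> p})"

text \<open>
  The chain represented by an arbitrary list: degenerate tuples count as \<open>0\<close>, and so does the empty
  list, which occurs only as the face of a \<open>0\<close>-tuple.
\<close>

definition rc_of :: "'a list \<Rightarrow> 'a list \<Rightarrow>\<^sub>0 int" where
  "rc_of xs = (if xs \<noteq> [] \<and> distinct_adj xs then frag_of xs else 0)"

definition rc_boundary :: "('a list \<Rightarrow>\<^sub>0 int) \<Rightarrow> ('a list \<Rightarrow>\<^sub>0 int)" where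
  "rc_boundary =
     frag_extend (\<lambda>xs. \<Sum>i < length xs. frag_cmul ((-1) ^ i) (rc_of (take i xs @ drop (Suc i) xs)))"

definition rc_map :: "('a \<Rightarrow> 'b) \<Rightarrow> ('a list \<Rightarrow>\<^sub>0 int) \<Rightarrow> ('b list \<Rightarrow>\<^sub>0 int)" where
  "rc_map f = frag_extend (\<lambda>xs. rc_of (map f xs))"

section \<open>The magnitude-path spectral sequence\<close>

definition mpss_Z :: "int \<Rightarrow> int \<Rightarrow> int \<Rightarrow> 'a pair_pre_digraph \<Rightarrow> ('a list \<Rightarrow>\<^sub>0 int) set" where
  "mpss_Z r p q X =
     {c \<in> rc_filtration X p (p + q). rc_boundary c \<in> rc_filtration X (p - r) (p + q - 1)}"

definition mpss_B :: "int \<Rightarrow> int \<Rightarrow> int \<Rightarrow> 'a pair_pre_digraph \<Rightarrow> ('a list \<Rightarrow>\<^sub>0 int) set" where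
  "mpss_B r p q X =
     mpss_Z (r - 1) (p - 1) (q + 1) X <#>\<^bsub>rc_group X (p + q)\<^esub>
     rc_boundary ` mpss_Z (r - 1) (p + r - 1) (q - r + 2) X"

definition mpss :: "int \<Rightarrow> int \<Rightarrow> int \<Rightarrow> 'a pair_pre_digraph \<Rightarrow> ('a list \<Rightarrow>\<^sub>0 int) set monoid" where
  "mpss r p q X = (rc_group X (p + q)) \<lparr>carrier := mpss_Z r p q X\<rparr> Mod mpss_B r p q X"

text \<open>
  The homomorphism \<open>E\<^sup>r\<^bsub>p,q\<^esub>(X) \<rightarrow> E\<^sup>r\<^bsub>p,q\<^esub>(Y)\<close> induced by \<open>f\<close>: for a class \<open>C\<close>, the classes
  of \<open>f\<^sub>#(c)\<close> for \<open>c \<in> C\<close> all coincide when \<open>f\<close> is a map of directed graphs.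
\<close>

definition mpss_map ::
  "int \<Rightarrow> int \<Rightarrow> int \<Rightarrow> 'b pair_pre_digraph \<Rightarrow> ('a \<Rightarrow> 'b) \<Rightarrow>
   ('a list \<Rightarrow>\<^sub>0 int) set \<Rightarrow> ('b list \<Rightarrow>\<^sub>0 int) set" where
  "mpss_map r p q Y f C =
     the_elem ((\<lambda>c. mpss_B r p q Y #>\<^bsub>rc_group Y (p + q)\<^esub> rc_map f c) ` C)"

section \<open>Exactness\<close>

text \<open>
  Exactness at \<open>H\<close> of \<open>G \<rightarrow> H \<rightarrow> K\<close>. The library's \<open>exact_seq\<close> requires all groups to have
  elements of the same type.
\<close>

definition exact_at ::
  "('a, 'm) monoid_scheme \<Rightarrow> ('a \<Rightarrow> 'b) \<Rightarrow> ('b, 'n) monoid_scheme \<Rightarrow> ('b \<Rightarrow> 'c) \<Rightarrow>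
   ('c, 'k) monoid_scheme \<Rightarrow> bool" where
  "exact_at G f H g K \<longleftrightarrow>
     group_hom G H f \<and> group_hom H K g \<and> f ` carrier G = kernel H K g"

end

theory Submission
  imports Defs
begin

text \<open>
  The group \<open>E\<^sup>s\<^bsub>1,0\<^esub>\<close> has an elementary description for \<open>s \<ge> 2\<close>.  Its cycles are the chains of
  edges with boundary zero, since the boundary has to lie in negative filtration.
  Its denominator is generated by the differences of two directed walks of length at most \<open>s\<close> with
  the same end points (\<open>walk_null_eq_boundaries\<close>).  The sequence thus becomes a Mayer--Vietoris
  sequence for edge cycles modulo short walks, and it can be checked on representatives
  (\<open>mayer_vietoris_quotients\<close>).

  Surjectivity is the usual argument.  Lift a cycle of the pushout to chains of edges of \<open>X\<close> and \<open>Y\<close>.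
  Their boundaries come from one vertex chain of \<open>A\<close> of augmentation zero; since \<open>A\<close> is connected it
  bounds in \<open>A\<close>, and the lifts can be corrected to cycles (\<open>cycles_onto\<close>).

  Exactness in the middle rests on the cofibration condition.  No edge of \<open>X\<close> enters \<open>A\<close> from outside,
  so a walk in the pushout crosses from \<open>Y\<close> to \<open>X\<close> at most once, at some point of \<open>A\<close>.  That point is
  not determined by the end points, but the retraction \<open>\<pi>\<close> makes it canonical: modulo relations in \<open>X\<close>,
  a walk from \<open>a\<close> in \<open>A\<close> to \<open>x\<close> of length at most \<open>s\<close> may be rerouted inside \<open>A\<close> to \<open>\<pi>(x)\<close> and from
  there along a fixed geodesic, with total length at most \<open>s\<close>, because \<open>r \<le> s\<close> (\<open>walk_through\<close>).
  Hence all relations of the pushout come from \<open>X\<close> and \<open>Y\<close> (\<open>walk_null_pushout\<close>).  Modulo these, a pair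
  of cycles in the kernel has equal images as chains of edges.  What the pushout can still identify are
  edges from different points of \<open>A\<close> to a common vertex outside \<open>A\<close>, and retracting such edges along
  \<open>\<pi>\<close> replaces the cycle in \<open>X\<close> by one in \<open>A\<close> (\<open>exact_middle\<close>).
\<close>


section \<open>Quotients of additive groups\<close>

definition add_group :: "'a::ab_group_add set \<Rightarrow> 'a monoid" where
  "add_group Z = \<lparr>carrier = Z, monoid.mult = (+), one = 0\<rparr>"

definition add_closed :: "'a::ab_group_add set \<Rightarrow> bool" where
  "add_closed Z \<longleftrightarrow> 0 \<in> Z \<and> (\<forall>x\<in>Z. \<forall>y\<in>Z. x - y \<in> Z)"

definition add_coset :: "'a::ab_group_add set \<Rightarrow> 'a \<Rightarrow> 'a set" where
  "add_coset N z = (\<lambda>n. n + z) ` N"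

lemma add_closedD:
  assumes "add_closed Z"
  shows "0 \<in> Z" and "\<And>x y. x \<in> Z \<Longrightarrow> y \<in> Z \<Longrightarrow> x - y \<in> Z"
    and "\<And>x. x \<in> Z \<Longrightarrow> - x \<in> Z" and "\<And>x y. x \<in> Z \<Longrightarrow> y \<in> Z \<Longrightarrow> x + y \<in> Z"
proof -
  show 0: "0 \<in> Z" and d: "\<And>x y. x \<in> Z \<Longrightarrow> y \<in> Z \<Longrightarrow> x - y \<in> Z"
    using assms by (auto simp: add_closed_def)
  show m: "- x \<in> Z" if "x \<in> Z" for x
    using d [OF 0 that] by simp
  show "x + y \<in> Z" if "x \<in> Z" "y \<in> Z" for x y
    using d [OF that(1) m [OF that(2)]] by simp
qed

lemma comm_group_add_group:
  assumes "add_closed Z" shows "comm_group (add_group Z)"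
proof (rule comm_groupI)
  show "\<exists>y\<in>carrier (add_group Z). y \<otimes>\<^bsub>add_group Z\<^esub> x = \<one>\<^bsub>add_group Z\<^esub>"
    if "x \<in> carrier (add_group Z)" for x
    using that add_closedD [OF assms] by (intro bexI [of _ "- x"]) (auto simp: add_group_def)
qed (use add_closedD [OF assms] in \<open>auto simp: add_group_def algebra_simps\<close>)

lemma inv_add_group:
  assumes "add_closed Z" "z \<in> Z" shows "inv\<^bsub>add_group Z\<^esub> z = - z"
proof -
  interpret comm_group "add_group Z" by (rule comm_group_add_group [OF assms(1)])
  show ?thesis
    by (rule inv_equality) (use add_closedD [OF assms(1)] assms(2) in \<open>auto simp: add_group_def\<close>)
qed

lemma add_coset_eq_iff:
  assumes "add_closed N"
  shows "add_coset N x = add_coset N y \<longleftrightarrow> x - y \<in> N"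
proof
  assume "add_coset N x = add_coset N y"
  moreover have "x \<in> add_coset N x"
    using add_closedD(1) [OF assms] by (force simp: add_coset_def)
  ultimately show "x - y \<in> N" by (auto simp: add_coset_def)
next
  assume d: "x - y \<in> N"
  show "add_coset N x = add_coset N y"
  proof (intro equalityI subsetI)
    fix w assume "w \<in> add_coset N x"
    then obtain n where "n \<in> N" "w = n + x" by (auto simp: add_coset_def)
    then show "w \<in> add_coset N y"
      using add_closedD(4) [OF assms _ d] by (auto simp: add_coset_def intro!: image_eqI [of _ _ "n + (x - y)"])
  next
    fix w assume "w \<in> add_coset N y"
    then obtain n where "n \<in> N" "w = n + y" by (auto simp: add_coset_def)
    then show "w \<in> add_coset N x"
      using add_closedD(2) [OF assms _ d] by (auto simp: add_coset_def intro!: image_eqI [of _ _ "n - (x - y)"])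
  qed
qed

lemma add_group_Mod:
  assumes Z: "add_closed Z" and N: "add_closed N" and sub: "N \<subseteq> Z"
  shows "comm_group (add_group Z Mod N)"
    and "carrier (add_group Z Mod N) = add_coset N ` Z"
    and "\<one>\<^bsub>add_group Z Mod N\<^esub> = add_coset N 0"
    and "\<And>x y. x \<in> Z \<Longrightarrow> y \<in> Z \<Longrightarrow>
           add_coset N x \<otimes>\<^bsub>add_group Z Mod N\<^esub> add_coset N y = add_coset N (x + y)"
    and "\<And>x. x \<in> Z \<Longrightarrow> inv\<^bsub>add_group Z Mod N\<^esub> add_coset N x = add_coset N (- x)"
proof -
  interpret Z: comm_group "add_group Z" by (rule comm_group_add_group [OF Z])
  have sg: "subgroup N (add_group Z)"
    using sub add_closedD [OF N]
    by (unfold_locales) (auto simp: inv_add_group [OF Z] subsetD [OF sub], auto simp: add_group_def)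
  then interpret N: normal N "add_group Z"
    by (rule Z.subgroup_imp_normal)
  have coset: "N #>\<^bsub>add_group Z\<^esub> x = add_coset N x" for x
    by (auto simp: r_coset_def add_coset_def add_group_def)
  show Q: "comm_group (add_group Z Mod N)"
    by (rule Z.abelian_FactGroup [OF sg])
  show car: "carrier (add_group Z Mod N) = add_coset N ` Z"
    by (auto simp: FactGroup_def RCOSETS_def coset) (auto simp: add_group_def)
  show one: "\<one>\<^bsub>add_group Z Mod N\<^esub> = add_coset N 0"
    by (auto simp: FactGroup_def add_coset_def)
  show mult: "add_coset N x \<otimes>\<^bsub>add_group Z Mod N\<^esub> add_coset N y = add_coset N (x + y)"
    if "x \<in> Z" "y \<in> Z" for x y
    using N.rcos_sum [of x y] that by (simp add: FactGroup_def coset) (simp add: add_group_def)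
  show "inv\<^bsub>add_group Z Mod N\<^esub> add_coset N x = add_coset N (- x)" if "x \<in> Z" for x
    by (rule group.inv_equality [OF comm_group.axioms(2) [OF Q]])
       (use that add_closedD [OF Z] in \<open>auto simp: car one mult simp del: mult_FactGroup one_FactGroup\<close>)
qed

text \<open>
  The diagram chase, separated from all geometry: once the three groups are presented as cycles
  modulo null elements, exactness of the sequence on cosets amounts to the two statements
  \<open>middle\<close> and \<open>onto\<close> about representatives.
\<close>

lemma mayer_vietoris_quotients:
  fixes f :: "'a::ab_group_add \<Rightarrow> 'b::ab_group_add" and h :: "'a \<Rightarrow> 'c::ab_group_add"
    and j :: "'b \<Rightarrow> 'd::ab_group_add" and k :: "'c \<Rightarrow> 'd"
  assumes Z: "add_closed ZA" "add_closed ZX" "add_closed ZY" "add_closed ZP"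
    and N: "add_closed NA" "add_closed NX" "add_closed NY" "add_closed NP"
    and NZ: "NA \<subseteq> ZA" "NX \<subseteq> ZX" "NY \<subseteq> ZY" "NP \<subseteq> ZP"
    and add: "Modules.additive f" "Modules.additive h" "Modules.additive j" "Modules.additive k"
    and mapZ: "f ` ZA \<subseteq> ZX" "h ` ZA \<subseteq> ZY" "j ` ZX \<subseteq> ZP" "k ` ZY \<subseteq> ZP"
    and \<alpha>: "\<And>w. w \<in> ZA \<Longrightarrow> \<alpha> (add_coset NA w) = (add_coset NX (f w), add_coset NY (h w))"
    and \<beta>: "\<And>u v. u \<in> ZX \<Longrightarrow> v \<in> ZY \<Longrightarrow>
           \<beta> (add_coset NX u, add_coset NY v) = add_coset NP (j u - k v)"
    and comm: "\<And>w. w \<in> ZA \<Longrightarrow> j (f w) = k (h w)"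
    and middle: "\<And>u v. u \<in> ZX \<Longrightarrow> v \<in> ZY \<Longrightarrow> j u - k v \<in> NP \<Longrightarrow>
           \<exists>w\<in>ZA. u - f w \<in> NX \<and> v - h w \<in> NY"
    and onto: "\<And>c. c \<in> ZP \<Longrightarrow> \<exists>u\<in>ZX. \<exists>v\<in>ZY. c = j u - k v"
  shows "exact_at (add_group ZA Mod NA) \<alpha> ((add_group ZX Mod NX) \<times>\<times> (add_group ZY Mod NY)) \<beta>
           (add_group ZP Mod NP) \<and>
         exact_at ((add_group ZX Mod NX) \<times>\<times> (add_group ZY Mod NY)) \<beta> (add_group ZP Mod NP)
           (\<lambda>_. ()) (singleton_group ())"
proof -
  note MA = add_group_Mod [OF Z(1) N(1) NZ(1)]
  note MX = add_group_Mod [OF Z(2) N(2) NZ(2)]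
  note MY = add_group_Mod [OF Z(3) N(3) NZ(3)]
  note MP = add_group_Mod [OF Z(4) N(4) NZ(4)]
  let ?A = "add_group ZA Mod NA" and ?P = "add_group ZP Mod NP"
    and ?H = "(add_group ZX Mod NX) \<times>\<times> (add_group ZY Mod NY)"
  have gr: "group ?A" "group ?P" "group ?H"
    using MA(1) MP(1) MX(1) MY(1) by (simp_all add: DirProd_group comm_group.axioms(2))
  have carH: "carrier ?H = add_coset NX ` ZX \<times> add_coset NY ` ZY"
    by (simp add: carrier_DirProd MX MY)
  note addf = additive.add [OF add(1)] and addh = additive.add [OF add(2)]
  have jk: "j u - k v \<in> ZP" if "u \<in> ZX" "v \<in> ZY" for u v
    using that mapZ(3,4) add_closedD(2) [OF Z(4)] by blast
  have hom\<alpha>: "group_hom ?A ?H \<alpha>"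
  proof (intro group_hom.intro group_hom_axioms.intro gr homI)
    fix x y assume "x \<in> carrier ?A" "y \<in> carrier ?A"
    then obtain w w' where w: "w \<in> ZA" "x = add_coset NA w" "w' \<in> ZA" "y = add_coset NA w'"
      by (auto simp: MA)
    have "f w \<in> ZX" "f w' \<in> ZX" "h w \<in> ZY" "h w' \<in> ZY" using w mapZ by auto
    then show "\<alpha> x \<in> carrier ?H" "\<alpha> (x \<otimes>\<^bsub>?A\<^esub> y) = \<alpha> x \<otimes>\<^bsub>?H\<^esub> \<alpha> y"
      using w add_closedD(4) [OF Z(1)] by (auto simp: MA MX MY \<alpha> carH addf addh simp del: mult_FactGroup)
  qed
  have hom\<beta>: "group_hom ?H ?P \<beta>"
  proof (intro group_hom.intro group_hom_axioms.intro gr homI)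
    fix x y assume "x \<in> carrier ?H" "y \<in> carrier ?H"
    then obtain u v u' v' where w: "u \<in> ZX" "v \<in> ZY" "x = (add_coset NX u, add_coset NY v)"
       "u' \<in> ZX" "v' \<in> ZY" "y = (add_coset NX u', add_coset NY v')"
      unfolding carH by blast
    then show "\<beta> x \<in> carrier ?P" "\<beta> (x \<otimes>\<^bsub>?H\<^esub> y) = \<beta> x \<otimes>\<^bsub>?P\<^esub> \<beta> y"
      using jk add_closedD(4) [OF Z(2)] add_closedD(4) [OF Z(3)]
      by (auto simp: MP MX MY \<beta> carH additive.add [OF add(3)] additive.add [OF add(4)] algebra_simps
               simp del: mult_FactGroup)
  qed
  have hom1: "group_hom ?P (singleton_group ()) (\<lambda>_. ())"
    by (intro group_hom.intro group_hom_axioms.intro gr singleton_group)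
       (auto simp: hom_def singleton_group_def)
  have ker: "\<alpha> ` carrier ?A = kernel ?H ?P \<beta>"
  proof (intro equalityI subsetI)
    fix x assume "x \<in> \<alpha> ` carrier ?A"
    then obtain w where w: "w \<in> ZA" "x = \<alpha> (add_coset NA w)" by (auto simp: MA)
    have "f w \<in> ZX" "h w \<in> ZY" using w mapZ by auto
    then show "x \<in> kernel ?H ?P \<beta>"
      using w by (auto simp: kernel_def \<alpha> \<beta> comm MX MY MP simp del: one_FactGroup)
  next
    fix x assume "x \<in> kernel ?H ?P \<beta>"
    then obtain u v where uv: "u \<in> ZX" "v \<in> ZY" "x = (add_coset NX u, add_coset NY v)"
      and "\<beta> x = \<one>\<^bsub>?P\<^esub>" unfolding kernel_def carH by blast
    then have "j u - k v \<in> NP" by (simp add: \<beta> MP add_coset_eq_iff [OF N(4)] del: one_FactGroup)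
    then obtain w where w: "w \<in> ZA" "u - f w \<in> NX" "v - h w \<in> NY" using middle uv by blast
    have "x = \<alpha> (add_coset NA w)"
      using w uv by (simp add: \<alpha> add_coset_eq_iff [OF N(2)] add_coset_eq_iff [OF N(3)])
    then show "x \<in> \<alpha> ` carrier ?A" using w by (auto simp: MA)
  qed
  have im: "\<beta> ` carrier ?H = kernel ?P (singleton_group ()) (\<lambda>_. ())"
  proof (intro equalityI subsetI)
    fix x assume "x \<in> \<beta> ` carrier ?H"
    then have "x \<in> carrier ?P" using group_hom.hom_closed [OF hom\<beta>] by auto
    then show "x \<in> kernel ?P (singleton_group ()) (\<lambda>_. ())"
      by (simp add: kernel_def singleton_group_def)
  next
    fix x assume "x \<in> kernel ?P (singleton_group ()) (\<lambda>_. ())"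
    then obtain c where c: "c \<in> ZP" "x = add_coset NP c" by (auto simp: kernel_def MP)
    then obtain u v where uv: "u \<in> ZX" "v \<in> ZY" "c = j u - k v" using onto by blast
    then have "x = \<beta> (add_coset NX u, add_coset NY v)" using c \<beta> by simp
    then show "x \<in> \<beta> ` carrier ?H" using uv unfolding carH by blast
  qed
  show ?thesis
    unfolding exact_at_def using hom\<alpha> hom\<beta> hom1 ker im by blast
qed

section \<open>Linear maps on chains\<close>

lemma additive_frag_extend: "Modules.additive (frag_extend f)"
  by (rule additive.intro) (rule frag_extend_add)

text \<open>
  Free abelian groups are used through their generators: identities between additive maps, and
  membership of their values in a subgroup, need only be checked on basis elements.
\<close>

lemma additive_eq_on_chains:
  assumes "Modules.additive f" "Modules.additive g"
    and "\<And>x. x \<in> S \<Longrightarrow> f (frag_of x) = g (frag_of x)"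
    and "Poly_Mapping.keys c \<subseteq> S"
  shows "f c = g c"
  using assms(4)
  by (induction c rule: frag_induction)
     (simp_all add: additive.zero additive.diff assms(1,2,3))

lemma additive_comp:
  assumes "Modules.additive f" "Modules.additive g"
  shows "Modules.additive (\<lambda>x. f (g x))"
  by (rule additive.intro) (simp add: additive.add [OF assms(1)] additive.add [OF assms(2)])

lemma additive_plus:
  fixes f g :: "'a::ab_group_add \<Rightarrow> 'b::ab_group_add"
  assumes "Modules.additive f" "Modules.additive g"
  shows "Modules.additive (\<lambda>x. f x + g x)"
  by (rule additive.intro) (simp add: additive.add [OF assms(1)] additive.add [OF assms(2)])

lemma additive_in_add_closed:
  assumes "add_closed N" "Modules.additive f"
    and "\<And>x. x \<in> S \<Longrightarrow> f (frag_of x) \<in> N"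
    and "Poly_Mapping.keys c \<subseteq> S"
  shows "f c \<in> N"
  using assms(4)
  by (induction c rule: frag_induction)
     (simp_all add: additive.zero additive.diff assms(2,3) add_closedD [OF assms(1)])

lemma additive_rc_boundary: "Modules.additive rc_boundary"
  unfolding rc_boundary_def by (rule additive_frag_extend)

lemma additive_rc_map: "Modules.additive (rc_map f)"
  unfolding rc_map_def by (rule additive_frag_extend)

lemma additive_ident: "Modules.additive (\<lambda>x. x)"
  by (rule additive.intro) simp

lemma additive_const_0: "Modules.additive (\<lambda>x. 0)"
  by (rule additive.intro) simp

lemmas additive_chain_maps =
  additive_comp [OF additive_rc_boundary] additive_comp [OF additive_rc_map]
  additive_plus additive_ident additive_const_0

lemmas rc_boundary_simps =
  additive.zero [OF additive_rc_boundary] additive.add [OF additive_rc_boundary]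
  additive.diff [OF additive_rc_boundary] additive.minus [OF additive_rc_boundary]

lemmas rc_map_simps =
  additive.zero [OF additive_rc_map] additive.add [OF additive_rc_map]
  additive.diff [OF additive_rc_map] additive.minus [OF additive_rc_map]

lemma rc_of_small [simp]:
  "rc_of [x] = frag_of [x]" "rc_of [x, y] = (if x = y then 0 else frag_of [x, y])"
  by (simp_all add: rc_of_def)

lemma rc_map_small [simp]:
  "rc_map f (frag_of [x]) = frag_of [f x]"
  "rc_map f (frag_of [x, y]) = rc_of [f x, f y]"
  by (simp_all add: rc_map_def)

lemma rc_boundary_small:
  "rc_boundary (frag_of [x, y]) = frag_of [y] - frag_of [x]"
  "rc_boundary (frag_of [x, y, z]) = rc_of [y, z] - rc_of [x, z] + rc_of [x, y]"
  by (simp_all add: rc_boundary_def numeral_2_eq_2 rc_of_def lessThan_Suc)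

definition vertex_chains :: "'a set \<Rightarrow> ('a list \<Rightarrow>\<^sub>0 int) set" where
  "vertex_chains V = {c. Poly_Mapping.keys c \<subseteq> {[x] | x. x \<in> V}}"

definition edge_chains :: "'a pair_pre_digraph \<Rightarrow> ('a list \<Rightarrow>\<^sub>0 int) set" where
  "edge_chains X = {c. Poly_Mapping.keys c \<subseteq> {[x, y] | x y. (x, y) \<in> parcs X}}"

definition edge_cycles :: "'a pair_pre_digraph \<Rightarrow> ('a list \<Rightarrow>\<^sub>0 int) set" where
  "edge_cycles X = {c \<in> edge_chains X. rc_boundary c = 0}"

lemma add_closed_keys: "add_closed {c :: 'a \<Rightarrow>\<^sub>0 int. Poly_Mapping.keys c \<subseteq> S}"
  using keys_diff by (fastforce simp: add_closed_def)

lemma add_closed_chains: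
  "add_closed (vertex_chains V)" "add_closed (edge_chains X)" "add_closed (edge_cycles X)"
proof -
  show "add_closed (vertex_chains V)" "add_closed (edge_chains X)"
    by (simp_all add: vertex_chains_def edge_chains_def add_closed_keys)
  then show "add_closed (edge_cycles X)"
    by (auto simp: edge_cycles_def add_closed_def rc_boundary_simps)
qed

lemma edge_chains_eqI:
  assumes "c \<in> edge_chains X" "Modules.additive f" "Modules.additive g"
    and "\<And>x y. (x, y) \<in> parcs X \<Longrightarrow> f (frag_of [x, y]) = g (frag_of [x, y])"
  shows "f c = g c"
  by (rule additive_eq_on_chains [of f g "{[x, y] | x y. (x, y) \<in> parcs X}"])
     (use assms in \<open>auto simp: edge_chains_def\<close>)

lemma vertex_chains_eqI:
  assumes "c \<in> vertex_chains V" "Modules.additive f" "Modules.additive g"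
    and "\<And>x. x \<in> V \<Longrightarrow> f (frag_of [x]) = g (frag_of [x])"
  shows "f c = g c"
  by (rule additive_eq_on_chains [of f g "{[x] | x. x \<in> V}"])
     (use assms in \<open>auto simp: vertex_chains_def\<close>)

lemma edge_chains_image:
  assumes "c \<in> edge_chains X" "add_closed N" "Modules.additive f"
    and "\<And>x y. (x, y) \<in> parcs X \<Longrightarrow> f (frag_of [x, y]) \<in> N"
  shows "f c \<in> N"
  by (rule additive_in_add_closed [of N f "{[x, y] | x y. (x, y) \<in> parcs X}"])
     (use assms in \<open>auto simp: edge_chains_def\<close>)

lemma vertex_chains_image:
  assumes "c \<in> vertex_chains V" "add_closed N" "Modules.additive f"
    and "\<And>x. x \<in> V \<Longrightarrow> f (frag_of [x]) \<in> N"
  shows "f c \<in> N"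
  by (rule additive_in_add_closed [of N f "{[x] | x. x \<in> V}"])
     (use assms in \<open>auto simp: vertex_chains_def\<close>)

lemma frag_of_in_chains [simp]:
  "frag_of [x] \<in> vertex_chains V \<longleftrightarrow> x \<in> V"
  "frag_of [x, y] \<in> edge_chains X \<longleftrightarrow> (x, y) \<in> parcs X"
  by (auto simp: vertex_chains_def edge_chains_def)

lemma rc_boundary_edge_chain:
  assumes "pair_loopfree_digraph X" "c \<in> edge_chains X"
  shows "rc_boundary c \<in> vertex_chains (pverts X)"
proof -
  interpret pair_loopfree_digraph X by fact
  show ?thesis
    using assms(2) add_closed_chains(1) additive_rc_boundary
    by (rule edge_chains_image)
       (auto simp: rc_boundary_small in_arcsD1 in_arcsD2 intro!: add_closedD [OF add_closed_chains(1)])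
qed

lemma rc_map_edge_chain:
  assumes "digraph_map X Y f" "c \<in> edge_chains X"
  shows "rc_map f c \<in> edge_chains Y"
  using assms(2) add_closed_chains(2) additive_rc_map
  by (rule edge_chains_image)
     (use assms(1) in \<open>auto simp: digraph_map_def add_closedD [OF add_closed_chains(2)]\<close>)

text \<open>
  An edge that is collapsed by \<open>f\<close> gives a degenerate pair, hence \<open>0\<close>, and the images of its end
  points cancel.
\<close>

lemma rc_map_boundary:
  assumes "c \<in> edge_chains X"
  shows "rc_boundary (rc_map f c) = rc_map f (rc_boundary c)"
  using assms
  by (rule edge_chains_eqI)
     (auto simp: rc_boundary_small rc_map_simps rc_boundary_simps
           intro!: additive_chain_maps)

lemma rc_map_cycle:
  assumes "digraph_map X Y f" "c \<in> edge_cycles X"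
  shows "rc_map f c \<in> edge_cycles Y"
  using assms rc_map_edge_chain [OF assms(1)] rc_map_boundary [of c X f]
  by (simp add: edge_cycles_def rc_map_simps)

lemma rc_map_compose_edge:
  assumes "c \<in> edge_chains X"
    and "\<And>x y. (x, y) \<in> parcs X \<Longrightarrow> f (g x) = f' (g' x) \<and> f (g y) = f' (g' y)"
  shows "rc_map f (rc_map g c) = rc_map f' (rc_map g' c)"
proof (rule edge_chains_eqI [OF assms(1)])
  show "rc_map f (rc_map g (frag_of [x, y])) = rc_map f' (rc_map g' (frag_of [x, y]))"
    if "(x, y) \<in> parcs X" for x y
  proof -
    have "rc_map f (rc_of [g x, g y]) = rc_of [f (g x), f (g y)]"
      "rc_map f' (rc_of [g' x, g' y]) = rc_of [f' (g' x), f' (g' y)]"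
      by (auto simp: rc_map_simps)
    then show ?thesis using assms(2) [OF that] by (simp del: rc_of_small)
  qed
qed (intro additive_chain_maps)+

lemma digraph_mapD:
  assumes "digraph_map X Y f"
  shows "x \<in> pverts X \<Longrightarrow> f x \<in> pverts Y"
    and "(x, y) \<in> parcs X \<Longrightarrow> (f x, f y) \<in> parcs Y \<or> f x = f y"
  using assms by (auto simp: digraph_map_def)

section \<open>Directed walks and their chains\<close>

text \<open>
  A walk is recorded by its end points, its length and the sum of its edges, which is all that a
  homology class in degree one can see.
\<close>

inductive walk_chain :: "'a pair_pre_digraph \<Rightarrow> 'a \<Rightarrow> 'a \<Rightarrow> nat \<Rightarrow> ('a list \<Rightarrow>\<^sub>0 int) \<Rightarrow> bool"
  for X where
  Nil: "x \<in> pverts X \<Longrightarrow> walk_chain X x x 0 0"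
| Snoc: "walk_chain X x y n c \<Longrightarrow> (y, z) \<in> parcs X \<Longrightarrow> walk_chain X x z (Suc n) (c + frag_of [y, z])"

lemma walk_chain_append:
  assumes "walk_chain X y z m d" "walk_chain X x y n c"
  shows "walk_chain X x z (n + m) (c + d)"
  using assms
  by (induction rule: walk_chain.induct) (auto simp: walk_chain.Snoc add.assoc [symmetric])

lemma walk_chain_edge:
  assumes "pair_loopfree_digraph X" "(x, y) \<in> parcs X"
  shows "walk_chain X x y 1 (frag_of [x, y])"
proof -
  interpret pair_loopfree_digraph X by fact
  show ?thesis
    using walk_chain.Snoc [OF walk_chain.Nil assms(2)] in_arcsD1 [OF assms(2)] by simp
qed

lemma walk_chain_verts:
  assumes "walk_chain X x y n c" "pair_loopfree_digraph X"
  shows "x \<in> pverts X" "y \<in> pverts X"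
proof -
  interpret pair_loopfree_digraph X by fact
  show "x \<in> pverts X" "y \<in> pverts X"
    using assms(1) by (induction rule: walk_chain.induct) (auto dest: in_arcsD2)
qed

lemma walk_chain_in_edge_chains:
  assumes "walk_chain X x y n c" shows "c \<in> edge_chains X"
  using assms
  by (induction rule: walk_chain.induct) (auto intro: add_closedD [OF add_closed_chains(2)])

lemma walk_chain_boundary:
  assumes "walk_chain X x y n c" shows "rc_boundary c = frag_of [y] - frag_of [x]"
  using assms
  by (induction rule: walk_chain.induct) (auto simp: rc_boundary_simps rc_boundary_small)

lemma walk_chain_le_1:
  assumes "walk_chain X x y n c" "n \<le> 1" "pair_loopfree_digraph X"
  shows "c = rc_of [x, y]"
proof -
  interpret pair_loopfree_digraph X by fact
  show ?thesis using assms(1,2) by (auto elim!: walk_chain.cases dest: pair_no_loops)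
qed

text \<open>
  The image of a walk may be shorter, because a map of directed graphs may collapse edges.
\<close>

lemma walk_chain_map:
  assumes "walk_chain X x y n c" "digraph_map X Y f"
  shows "\<exists>m\<le>n. walk_chain Y (f x) (f y) m (rc_map f c)"
  using assms(1)
proof (induction rule: walk_chain.induct)
  case (Nil x)
  then show ?case
    using assms(2) by (auto simp: rc_map_simps digraph_map_def intro!: walk_chain.Nil)
next
  case (Snoc x y n c z)
  then obtain m where m: "m \<le> n" "walk_chain Y (f x) (f y) m (rc_map f c)" by blast
  consider "f y = f z" | "f y \<noteq> f z" "(f y, f z) \<in> parcs Y"
    using digraph_mapD(2) [OF assms(2) Snoc(2)] by blast
  then show ?case
  proof cases
    case 1
    then show ?thesis using m by (auto simp: rc_map_simps intro!: exI [of _ m])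
  next
    case 2
    then show ?thesis
      using m walk_chain.Snoc [OF m(2) 2(2)] by (auto simp: rc_map_simps intro!: exI [of _ "Suc m"])
  qed
qed

lemma walk_chain_relpow:
  assumes "walk_chain X x y n c" shows "(x, y) \<in> parcs X ^^ n"
  using assms by (induction rule: walk_chain.induct) auto

lemma relpow_walk_chain:
  assumes "(x, y) \<in> parcs X ^^ n" "x \<in> pverts X"
  shows "\<exists>c. walk_chain X x y n c"
  using assms(1)
proof (induction n arbitrary: y)
  case 0
  then show ?case using assms(2) by (auto intro: walk_chain.Nil)
next
  case (Suc n)
  then obtain z where "(x, z) \<in> parcs X ^^ n" "(z, y) \<in> parcs X" by auto
  then show ?case using Suc.IH walk_chain.Snoc by metis
qed

lemma ddist_le:
  assumes "walk_chain X x y n c" shows "ddist X x y \<le> enat n"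
  unfolding ddist_def using walk_chain_relpow [OF assms] by (intro INF_lower) auto

lemma ddist_attained:
  assumes "ddist X x y = enat n" shows "(x, y) \<in> parcs X ^^ n"
proof -
  let ?S = "enat ` {n. (x, y) \<in> parcs X ^^ n}"
  have "?S \<noteq> {}"
  proof
    assume "?S = {}"
    then have "ddist X x y = \<infinity>" unfolding ddist_def by (simp only: Inf_enat_def) simp
    then show False using assms by simp
  qed
  then have "Inf ?S \<in> ?S"
    using wellorder_InfI [of _ ?S] by blast
  then show ?thesis using assms unfolding ddist_def by (metis (mono_tags, lifting) enat.inject imageE mem_Collect_eq)
qed

lemma ddist_geodesic:
  assumes "ddist X x y = enat n" "x \<in> pverts X"
  shows "\<exists>c. walk_chain X x y n c"
  using relpow_walk_chain [OF ddist_attained [OF assms(1)] assms(2)] .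

lemma ddist_eq_0 [simp]: "ddist X x y = 0 \<longleftrightarrow> x = y"
proof
  assume "ddist X x y = 0"
  then show "x = y" using ddist_attained [of X x y 0] by (simp add: zero_enat_def)
next
  assume "x = y"
  then have "ddist X x y \<le> enat 0" unfolding ddist_def by (intro INF_lower) auto
  then show "ddist X x y = 0" by (simp add: zero_enat_def [symmetric])
qed

text \<open>
  The chains that become \<open>0\<close> in \<open>E\<^sup>s\<^bsub>1,0\<^esub>\<close>: any two walks of length at most \<open>s\<close> with common end
  points are identified.  Comparison with the empty walk shows that closed walks of length at
  most \<open>s\<close> are null.
\<close>

inductive_set walk_null :: "nat \<Rightarrow> 'a pair_pre_digraph \<Rightarrow> ('a list \<Rightarrow>\<^sub>0 int) set"
  for s X where
  zero: "0 \<in> walk_null s X"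
| walks: "walk_chain X x y m c \<Longrightarrow> walk_chain X x y n d \<Longrightarrow> m \<le> s \<Longrightarrow> n \<le> s \<Longrightarrow> c - d \<in> walk_null s X"
| diff: "c \<in> walk_null s X \<Longrightarrow> d \<in> walk_null s X \<Longrightarrow> c - d \<in> walk_null s X"

lemma add_closed_walk_null: "add_closed (walk_null s X)"
  by (auto simp: add_closed_def intro: walk_null.zero walk_null.diff)

lemma walk_null_subset_cycles: "walk_null s X \<subseteq> edge_cycles X"
proof
  fix c assume "c \<in> walk_null s X"
  then show "c \<in> edge_cycles X"
  proof induction
    case (walks x y m c n d)
    then have "c - d \<in> edge_chains X"
      by (blast intro: add_closedD(2) [OF add_closed_chains(2)] walk_chain_in_edge_chains)
    then show ?case
      using walks by (simp add: edge_cycles_def rc_boundary_simps walk_chain_boundary)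
  qed (use add_closedD [OF add_closed_chains(3)] in auto)
qed

lemma walk_null_in:
  assumes "add_closed N" "Modules.additive f"
    and "\<And>x y m c n d. walk_chain X x y m c \<Longrightarrow> walk_chain X x y n d \<Longrightarrow> m \<le> s \<Longrightarrow> n \<le> s \<Longrightarrow>
           f c - f d \<in> N"
    and "c \<in> walk_null s X"
  shows "f c \<in> N"
  using assms(4)
  by induction (use assms(1-3) in \<open>auto simp: additive.zero additive.diff add_closedD\<close>)

lemma rc_map_walk_null:
  assumes "digraph_map X Y f" "c \<in> walk_null s X"
  shows "rc_map f c \<in> walk_null s Y"
  using add_closed_walk_null additive_rc_map _ assms(2)
proof (rule walk_null_in)
  fix x y m c n d
  assume "walk_chain X x y m c" "walk_chain X x y n d" "m \<le> s" "n \<le> s"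
  then show "rc_map f c - rc_map f d \<in> walk_null s Y"
    using walk_chain_map [OF _ assms(1)] by (meson order_trans walk_null.walks)
qed

section \<open>Edge cycles modulo directed walks\<close>

lemma tuple_length_small:
  "tuple_length X [x] = 0"
  "tuple_length X [x, y] = ddist X x y"
  "tuple_length X [x, y, z] = ddist X x y + ddist X y z"
  by (simp_all add: tuple_length_def numeral_2_eq_2 lessThan_Suc add.commute)

lemma ddist_eq_1_iff:
  assumes "pair_loopfree_digraph X"
  shows "ddist X x y = enat 1 \<longleftrightarrow> (x, y) \<in> parcs X"
proof
  assume "ddist X x y = enat 1"
  then show "(x, y) \<in> parcs X" using ddist_attained [of X x y 1] by simp
next
  assume e: "(x, y) \<in> parcs X"
  interpret pair_loopfree_digraph X by fact
  have "ddist X x y \<le> enat 1" using ddist_le [OF walk_chain_edge [OF assms e]] .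
  moreover have "ddist X x y \<noteq> 0" using pair_no_loops [OF e] by simp
  ultimately show "ddist X x y = enat 1"
    by (cases "ddist X x y") (auto simp: zero_enat_def)
qed

lemma rc_tuples_1: "rc_tuples X 1 =
    {[x, y] | x y. x \<in> pverts X \<and> y \<in> pverts X \<and> x \<noteq> y \<and> ddist X x y < \<infinity>}"
  by (auto simp: rc_tuples_def length_Suc_conv numeral_2_eq_2 tuple_length_small
    dest!: arg_cong [of _ "2::int" nat])

lemma rc_tuples_2: "rc_tuples X 2 =
    {[x, y, z] | x y z. x \<in> pverts X \<and> y \<in> pverts X \<and> z \<in> pverts X \<and> x \<noteq> y \<and> y \<noteq> z \<and>
       ddist X x y + ddist X y z < \<infinity>}"
  by (auto simp: rc_tuples_def length_Suc_conv numeral_3_eq_3 tuple_length_small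
    dest!: arg_cong [of _ "3::int" nat])

lemma rc_filtration_1_1:
  assumes "pair_loopfree_digraph X"
  shows "rc_filtration X 1 1 = edge_chains X"
proof -
  interpret pair_loopfree_digraph X by fact
  have "{xs \<in> rc_tuples X 1. \<exists>m. tuple_length X xs = enat m \<and> int m \<le> 1} =
    {[x, y] | x y. (x, y) \<in> parcs X}"
  proof (intro equalityI subsetI)
    fix xs assume "xs \<in> {xs \<in> rc_tuples X 1. \<exists>m. tuple_length X xs = enat m \<and> int m \<le> 1}"
    then obtain x y m where xy: "xs = [x, y]" "x \<noteq> y" "ddist X x y = enat m" "int m \<le> 1"
      by (auto simp: rc_tuples_1 tuple_length_small)
    then have "m \<noteq> 0" using ddist_eq_0 [of X x y] by (metis enat_0)
    then have "m = 1" using xy by simp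
    then show "xs \<in> {[x, y] | x y. (x, y) \<in> parcs X}"
      using xy ddist_eq_1_iff [OF assms] by auto
  next
    fix xs assume "xs \<in> {[x, y] | x y. (x, y) \<in> parcs X}"
    then obtain x y where xy: "xs = [x, y]" "(x, y) \<in> parcs X" by auto
    then show "xs \<in> {xs \<in> rc_tuples X 1. \<exists>m. tuple_length X xs = enat m \<and> int m \<le> 1}"
      using ddist_eq_1_iff [OF assms, of x y] pair_no_loops [OF xy(2)] in_arcsD1 [OF xy(2)] in_arcsD2 [OF xy(2)]
      by (auto simp: rc_tuples_1 tuple_length_small)
  qed
  then show ?thesis by (simp add: rc_filtration_def free_Abelian_group_def edge_chains_def)
qed

lemma rc_filtration_0_1: "rc_filtration X 0 1 = {0}"
proof -
  have "{xs \<in> rc_tuples X 1. \<exists>m. tuple_length X xs = enat m \<and> int m \<le> 0} = {}"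
    by (auto simp: rc_tuples_1 tuple_length_small enat_0)
  then show ?thesis unfolding rc_filtration_def free_Abelian_group_def by (simp only:) simp
qed

lemma rc_filtration_neg:
  assumes "p < 0" shows "rc_filtration X p n = {0}"
proof -
  have "{xs \<in> rc_tuples X n. \<exists>m. tuple_length X xs = enat m \<and> int m \<le> p} = {}"
    using assms by auto
  then show ?thesis unfolding rc_filtration_def free_Abelian_group_def by (simp only:) simp
qed

text \<open>
  For \<open>s \<ge> 2\<close> the boundary is required to lie in negative filtration, that is, to vanish.
\<close>

lemma mpss_Z_cycles:
  assumes "pair_loopfree_digraph X" "2 \<le> s"
  shows "mpss_Z (int s) 1 0 X = edge_cycles X"
  using assms rc_filtration_neg [of "1 - int s" X 0]
  by (auto simp: mpss_Z_def edge_cycles_def rc_filtration_1_1)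

lemma add_closed_rc_filtration: "add_closed (rc_filtration X p n)"
  by (simp add: rc_filtration_def free_Abelian_group_def add_closed_keys)

lemma triple_in_rc_filtration:
  assumes "walk_chain X x y m c" "walk_chain X y z n d" "m + n \<le> s" "x \<noteq> y" "y \<noteq> z"
    and "pair_loopfree_digraph X"
  shows "frag_of [x, y, z] \<in> rc_filtration X (int s) 2"
proof -
  have "ddist X x y + ddist X y z \<le> enat m + enat n"
    using ddist_le [OF assms(1)] ddist_le [OF assms(2)] by (rule add_mono)
  then have "ddist X x y + ddist X y z \<le> enat (m + n)" by simp
  then obtain k where k: "ddist X x y + ddist X y z = enat k" "k \<le> m + n"
    by (metis enat_ile enat_ord_simps(1))
  then have "[x, y, z] \<in> {xs \<in> rc_tuples X 2. \<exists>m. tuple_length X xs = enat m \<and> int m \<le> int s}"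
    using assms walk_chain_verts [OF assms(1,6)] walk_chain_verts [OF assms(2,6)]
    by (auto simp: rc_tuples_2 tuple_length_small)
  then show ?thesis
    unfolding rc_filtration_def by (simp add: free_Abelian_group_def)
qed

text \<open>
  A short walk is homologous, through tuples of length at most \<open>s\<close>, to the single pair formed by its
  end points: the triangles \<open>(x, x\<^sub>i, x\<^sub>i\<^sub>+\<^sub>1)\<close> over the edges of the walk shorten it step by
  step.  For a closed walk the pair is degenerate and counts as \<open>0\<close>.
\<close>

lemma walk_chain_homologous_to_endpoints:
  assumes "walk_chain X x y n c" "n \<le> s" "pair_loopfree_digraph X"
  shows "\<exists>b \<in> rc_filtration X (int s) 2. rc_boundary b = c - rc_of [x, y]"
  using assms(1,2)
proof (induction rule: walk_chain.induct)
  case (Nil x)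
  then show ?case
    using add_closedD(1) [OF add_closed_rc_filtration] by (force simp: rc_boundary_simps)
next
  case (Snoc x y n c z)
  interpret pair_loopfree_digraph X by fact
  obtain b where b: "b \<in> rc_filtration X (int s) 2" "rc_boundary b = c - rc_of [x, y]"
    using Snoc by auto
  have yz: "y \<noteq> z" using pair_no_loops [OF Snoc(2)] by simp
  show ?case
  proof (cases "x = y")
    case True
    then show ?thesis using b yz by auto
  next
    case False
    have "frag_of [x, y, z] \<in> rc_filtration X (int s) 2"
      by (rule triple_in_rc_filtration [OF Snoc(1) walk_chain_edge [OF assms(3) Snoc(2)]])
         (use Snoc False yz assms in auto)
    then have "b + frag_of [x, y, z] \<in> rc_filtration X (int s) 2"
      using b add_closedD(4) [OF add_closed_rc_filtration] by blast
    moreover have "rc_boundary (b + frag_of [x, y, z]) = c + frag_of [y, z] - rc_of [x, z]"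
      using b yz False by (simp add: rc_boundary_simps rc_boundary_small)
    ultimately show ?thesis by blast
  qed
qed

text \<open>
  Both sides describe the denominator of \<open>E\<^sup>s\<^bsub>1,0\<^esub>\<close>.  Two walks with the same end points differ by a
  boundary because each is homologous to the pair of its end points.  Conversely, replacing every
  pair by a geodesic is a linear map that fixes chains of edges and sends the boundary of a triple
  of length at most \<open>s\<close> to the difference between a concatenation of two geodesics and a third one.
\<close>

lemma walk_null_eq_boundaries:
  fixes X :: "'a pair_pre_digraph"
  assumes X: "pair_loopfree_digraph X"
  shows "rc_boundary ` {b \<in> rc_filtration X (int s) 2. rc_boundary b \<in> edge_chains X} = walk_null s X"
    (is "rc_boundary ` ?Z = _")
proof (intro equalityI subsetI)
  interpret pair_loopfree_digraph X by fact
  fix c assume "c \<in> rc_boundary ` ?Z"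
  then obtain b where b: "b \<in> rc_filtration X (int s) 2" "rc_boundary b \<in> edge_chains X"
    "c = rc_boundary b" by auto
  define \<gamma> where "\<gamma> x y = (SOME c. walk_chain X x y (the_enat (ddist X x y)) c)" for x y
  have \<gamma>: "walk_chain X x y n (\<gamma> x y)" if "ddist X x y = enat n" "x \<in> pverts X" for x y n
    unfolding \<gamma>_def using someI_ex [OF ddist_geodesic [OF that]] that(1) by simp
  define \<psi> :: "('a list \<Rightarrow>\<^sub>0 int) \<Rightarrow> ('a list \<Rightarrow>\<^sub>0 int)" where
    "\<psi> = frag_extend (\<lambda>xs. \<gamma> (hd xs) (last xs))"
  have add: "Modules.additive \<psi>" unfolding \<psi>_def by (rule additive_frag_extend)
  have \<psi>: "\<psi> (frag_of [x, y]) = \<gamma> x y" for x y by (simp add: \<psi>_def)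
  have "\<psi> c = c"
  proof (rule edge_chains_eqI [where g = "\<lambda>c. c"])
    fix x y assume e: "(x, y) \<in> parcs X"
    then have "walk_chain X x y 1 (\<gamma> x y)"
      using \<gamma> [of x y 1] ddist_eq_1_iff [OF X] in_arcsD1 by auto
    then show "\<psi> (frag_of [x, y]) = frag_of [x, y]"
      using walk_chain_le_1 [of X x y 1 "\<gamma> x y", OF _ _ X] pair_no_loops [OF e] by (auto simp: \<psi>)
  qed (use b add additive_ident in auto)
  moreover have "\<psi> (rc_boundary b) \<in> walk_null s X"
  proof (rule additive_in_add_closed [OF add_closed_walk_null additive_comp [OF add additive_rc_boundary]])
    show "Poly_Mapping.keys b \<subseteq> {xs \<in> rc_tuples X 2. \<exists>m. tuple_length X xs = enat m \<and> int m \<le> int s}"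
      using b(1) by (simp add: rc_filtration_def free_Abelian_group_def)
  next
    fix xs assume "xs \<in> {xs \<in> rc_tuples X 2. \<exists>m. tuple_length X xs = enat m \<and> int m \<le> int s}"
    then obtain x y z m where xyz: "xs = [x, y, z]" "x \<in> pverts X" "y \<in> pverts X" "x \<noteq> y" "y \<noteq> z"
      "ddist X x y + ddist X y z = enat m" "m \<le> s"
      by (auto simp: rc_tuples_2 tuple_length_small)
    then obtain k l where kl: "ddist X x y = enat k" "ddist X y z = enat l" "k + l = m"
      by (cases "ddist X x y"; cases "ddist X y z") auto
    have w: "walk_chain X x z (k + l) (\<gamma> x y + \<gamma> y z)"
      by (rule walk_chain_append [OF \<gamma> \<gamma>]) (use kl xyz in auto)
    obtain v n where v: "walk_chain X x z n v" "n \<le> s" "\<psi> (rc_of [x, z]) = v"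
    proof (cases "x = z")
      case True
      then show ?thesis
        using that [of 0 0] walk_chain.Nil [OF xyz(2)] by (simp add: additive.zero [OF add])
    next
      case False
      obtain n where n: "ddist X x z = enat n" "n \<le> k + l"
        using ddist_le [OF w] by (metis enat_ile enat_ord_simps(1))
      then show ?thesis
        using that [OF \<gamma> [OF n(1) xyz(2)]] False kl xyz by (simp add: \<psi>)
    qed
    have "(\<gamma> x y + \<gamma> y z) - v \<in> walk_null s X"
      using walk_null.walks [OF w v(1)] v(2) kl xyz by simp
    moreover have "\<psi> (rc_boundary (frag_of xs)) = (\<gamma> x y + \<gamma> y z) - v"
      unfolding xyz(1) rc_boundary_small(2) additive.add [OF add] additive.diff [OF add] v(3)
      using xyz by (simp add: \<psi>)
    ultimately show "\<psi> (rc_boundary (frag_of xs)) \<in> walk_null s X" by simp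
  qed
  ultimately show "c \<in> walk_null s X" using b(3) by simp
next
  fix c assume "c \<in> walk_null s X"
  then show "c \<in> rc_boundary ` ?Z"
  proof induction
    case zero
    show ?case
      using add_closedD(1) [OF add_closed_rc_filtration] add_closedD(1) [OF add_closed_chains(2)]
      by (intro image_eqI [of _ _ 0]) (auto simp: rc_boundary_simps)
  next
    case (walks x y m c n d)
    obtain b b' where b: "b \<in> rc_filtration X (int s) 2" "rc_boundary b = c - rc_of [x, y]"
      "b' \<in> rc_filtration X (int s) 2" "rc_boundary b' = d - rc_of [x, y]"
      using walk_chain_homologous_to_endpoints [OF _ _ X] walks by meson
    have "c - d \<in> edge_chains X"
      using walks by (blast intro: add_closedD(2) [OF add_closed_chains(2)] walk_chain_in_edge_chains)
    moreover have "b - b' \<in> rc_filtration X (int s) 2"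
      using b by (blast intro: add_closedD(2) [OF add_closed_rc_filtration])
    moreover have "rc_boundary (b - b') = c - d"
      using b by (simp add: rc_boundary_simps)
    ultimately show ?case by (intro image_eqI [of _ _ "b - b'"]) auto
  next
    case (diff c d)
    then obtain b b' where "b \<in> ?Z" "c = rc_boundary b" "b' \<in> ?Z" "d = rc_boundary b'" by auto
    then show ?case
      by (intro image_eqI [of _ _ "b - b'"])
         (auto simp: rc_boundary_simps add_closedD(2) [OF add_closed_rc_filtration]
           add_closedD(2) [OF add_closed_chains(2)])
  qed
qed

text \<open>
  The first summand of the denominator vanishes, since two distinct vertices never have distance \<open>0\<close>.
\<close>

lemma mpss_B_walk_null:
  assumes "pair_loopfree_digraph X" "2 \<le> s"
  shows "mpss_B (int s) 1 0 X = walk_null s X"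
proof -
  have "mpss_Z (int s - 1) 0 1 X = {0}"
    using add_closedD(1) [OF add_closed_rc_filtration]
    by (auto simp: mpss_Z_def rc_filtration_0_1 rc_boundary_simps)
  moreover have "mpss_Z (int s - 1) (int s) (2 - int s) X =
      {b \<in> rc_filtration X (int s) 2. rc_boundary b \<in> edge_chains X}"
    by (simp add: mpss_Z_def rc_filtration_1_1 [OF assms(1)])
  ultimately have "mpss_B (int s) 1 0 X = {0} <#>\<^bsub>rc_group X 1\<^esub> walk_null s X"
    by (simp add: mpss_B_def walk_null_eq_boundaries [OF assms(1)])
  then show ?thesis by (auto simp: set_mult_def rc_group_def)
qed

lemma mpss_1_0:
  assumes "pair_loopfree_digraph X" "2 \<le> s"
  shows "mpss (int s) 1 0 X = add_group (edge_cycles X) Mod walk_null s X"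
  using assms
  by (simp add: mpss_def mpss_Z_cycles mpss_B_walk_null rc_group_def free_Abelian_group_def add_group_def)

lemma mpss_map_1_0:
  assumes "pair_loopfree_digraph Y" "2 \<le> s" "digraph_map X Y f"
  shows "mpss_map (int s) 1 0 Y f (add_coset (walk_null s X) c) =
         add_coset (walk_null s Y) (rc_map f c)"
proof -
  have coset: "mpss_B (int s) 1 0 Y #>\<^bsub>rc_group Y (1 + 0)\<^esub> d = add_coset (walk_null s Y) d" for d
    by (auto simp: mpss_B_walk_null [OF assms(1,2)] r_coset_def add_coset_def rc_group_def)
  have "add_coset (walk_null s Y) (rc_map f (n + c)) = add_coset (walk_null s Y) (rc_map f c)"
    if "n \<in> walk_null s X" for n
    using rc_map_walk_null [OF assms(3) that]
    by (simp add: add_coset_eq_iff [OF add_closed_walk_null] rc_map_simps)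
  then have "(\<lambda>c. add_coset (walk_null s Y) (rc_map f c)) ` add_coset (walk_null s X) c =
      {add_coset (walk_null s Y) (rc_map f c)}"
    using walk_null.zero by (fastforce simp: add_coset_def)
  then show ?thesis unfolding mpss_map_def coset by simp
qed

section \<open>Gluing along a cofibration\<close>

text \<open>
  The features of the pushout square that the argument uses.  The map \<open>\<pi>\<close> is the retraction of the
  cofibration, with values moved back to \<open>A\<close>; its metric conditions are merged into one: a vertex at
  distance \<open>m \<le> s\<close> from \<open>a\<close> is reached through \<open>\<pi> x\<close> within total length \<open>s\<close>, and \<open>\<pi> x\<close> is no
  farther from \<open>a\<close> than \<open>x\<close> is.  As a set, the pushout is \<open>Y\<close> together with the vertices of \<open>X\<close>
  outside \<open>A\<close>.
\<close>

locale cofibration_gluing =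
  fixes A :: "'a pair_pre_digraph" and X :: "'b pair_pre_digraph" and Y :: "'c pair_pre_digraph"
    and P :: "'d pair_pre_digraph"
    and \<phi>X :: "'a \<Rightarrow> 'b" and \<phi>Y :: "'a \<Rightarrow> 'c" and jX :: "'b \<Rightarrow> 'd" and jY :: "'c \<Rightarrow> 'd"
    and \<pi> :: "'b \<Rightarrow> 'a" and s :: nat
  assumes loopA: "pair_loopfree_digraph A" and loopX: "pair_loopfree_digraph X"
    and loopY: "pair_loopfree_digraph Y" and loopP: "pair_loopfree_digraph P"
    and \<phi>X: "digraph_map A X \<phi>X" and \<phi>Y: "digraph_map A Y \<phi>Y"
    and jX: "digraph_map X P jX" and jY: "digraph_map Y P jY"
    and induced: "induced_inclusion A X \<phi>X"
    and no_return: "(x, x') \<in> parcs X \<Longrightarrow> x' \<in> \<phi>X ` pverts A \<Longrightarrow> x \<in> \<phi>X ` pverts A"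
    and s: "s \<ge> 1"
    and \<pi>: "a \<in> pverts A \<Longrightarrow> x \<in> pverts X \<Longrightarrow> ddist X (\<phi>X a) x = enat m \<Longrightarrow> m \<le> s \<Longrightarrow>
       \<pi> x \<in> pverts A \<and> (\<exists>k l. ddist X (\<phi>X a) (\<phi>X (\<pi> x)) = enat k \<and>
         ddist X (\<phi>X (\<pi> x)) x = enat l \<and> k \<le> m \<and> k + l \<le> s)"
    and glue: "a \<in> pverts A \<Longrightarrow> jX (\<phi>X a) = jY (\<phi>Y a)"
    and jY_eq: "jY y = jY y' \<Longrightarrow> y = y'"
    and jX_jY_eq: "jX x = jY y \<Longrightarrow> \<exists>a\<in>pverts A. x = \<phi>X a \<and> y = \<phi>Y a"
    and jX_eq: "x \<notin> \<phi>X ` pverts A \<Longrightarrow> jX x = jX x' \<Longrightarrow> x = x'"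
    and verts: "p \<in> pverts P \<Longrightarrow> p \<in> jX ` pverts X \<union> jY ` pverts Y"
    and edges: "(p, q) \<in> parcs P \<Longrightarrow> p \<noteq> q \<and>
       ((\<exists>x x'. (x, x') \<in> parcs X \<and> p = jX x \<and> q = jX x') \<or>
        (\<exists>y y'. (y, y') \<in> parcs Y \<and> p = jY y \<and> q = jY y'))"
begin

abbreviation AX :: "'b set" where "AX \<equiv> \<phi>X ` pverts A"

lemma glue_edge:
  assumes "c \<in> edge_chains A"
  shows "rc_map jX (rc_map \<phi>X c) = rc_map jY (rc_map \<phi>Y c)"
proof (rule rc_map_compose_edge [OF assms])
  fix x y assume e: "(x, y) \<in> parcs A"
  interpret pair_loopfree_digraph A by (rule loopA)
  show "jX (\<phi>X x) = jY (\<phi>Y x) \<and> jX (\<phi>X y) = jY (\<phi>Y y)"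
    using glue in_arcsD1 [OF e] in_arcsD2 [OF e] by simp
qed

lemma edge_in_A:
  assumes "(x, \<phi>X b) \<in> parcs X" "b \<in> pverts A"
  shows "\<exists>a \<in> pverts A. x = \<phi>X a \<and> (a, b) \<in> parcs A"
proof -
  obtain a where "a \<in> pverts A" "x = \<phi>X a"
    using no_return [OF assms(1)] assms(2) by blast
  then show ?thesis using assms induced unfolding induced_inclusion_def by blast
qed

text \<open>
  An edge of \<open>X\<close> that ends in \<open>A\<close> already starts there; unless the pushout collapses it, its image is an
  edge of \<open>Y\<close>.
\<close>

lemma edges_cases:
  assumes "(p, q) \<in> parcs P"
  obtains (Y) y y' where "(y, y') \<in> parcs Y" "p = jY y" "q = jY y'"
  | (X) x x' where "(x, x') \<in> parcs X" "x' \<notin> AX" "p = jX x" "q = jX x'"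
proof -
  consider y y' where "(y, y') \<in> parcs Y" "p = jY y" "q = jY y'"
    | x x' where "(x, x') \<in> parcs X" "p = jX x" "q = jX x'"
    using edges [OF assms] by blast
  then show thesis
  proof cases
    case 1 then show thesis by (rule Y)
  next
    case (2 x x')
    show thesis
    proof (cases "x' \<in> AX")
      case True
      then obtain b where b: "b \<in> pverts A" "x' = \<phi>X b" by auto
      then obtain a where a: "a \<in> pverts A" "x = \<phi>X a" "(a, b) \<in> parcs A"
        using edge_in_A 2 by blast
      have "\<phi>Y a \<noteq> \<phi>Y b"
        using edges [OF assms] glue a b 2 by auto
      then have "(\<phi>Y a, \<phi>Y b) \<in> parcs Y" using digraph_mapD(2) [OF \<phi>Y a(3)] by simp
      then show thesis using Y glue a b 2 by auto
    next
      case False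
      then show thesis using X 2 by blast
    qed
  qed
qed

section \<open>Walks in the pushout\<close>

lemma walk_in_A:
  assumes "walk_chain X x y n c" "y \<in> AX"
  shows "\<exists>a b d. x = \<phi>X a \<and> y = \<phi>X b \<and> walk_chain A a b n d \<and> c = rc_map \<phi>X d"
  using assms
proof (induction rule: walk_chain.induct)
  case (Nil x)
  then show ?case
    using walk_chain.Nil by (fastforce simp: rc_map_simps)
next
  case (Snoc x y n c z)
  interpret X: pair_loopfree_digraph X by (rule loopX)
  obtain b where b: "b \<in> pverts A" "z = \<phi>X b" using Snoc.prems by auto
  then obtain b' where b': "b' \<in> pverts A" "y = \<phi>X b'" "(b', b) \<in> parcs A"
    using edge_in_A Snoc.hyps by blast
  obtain a d where d: "x = \<phi>X a" "walk_chain A a b' n d" "c = rc_map \<phi>X d"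
    using Snoc.IH b' walk_chain_verts(2) [OF _ loopA] induced
    unfolding induced_inclusion_def inj_on_def by (metis imageI)
  have "\<phi>X b' \<noteq> \<phi>X b" using X.pair_no_loops [OF Snoc.hyps(2)] b b' by simp
  then show ?case
    using walk_chain.Snoc [OF d(2) b'(3)] b b' d
    by (intro exI [of _ a] exI [of _ b] exI [of _ "d + frag_of [b', b]"]) (simp add: rc_map_simps)
qed

text \<open>
  A geodesic from \<open>\<pi> x\<close> to \<open>x\<close>.  It does not depend on the point of \<open>A\<close> from which \<open>x\<close> is reached,
  which is why it cancels whenever two walks that end at \<open>x\<close> are compared.
\<close>

definition through :: "'b \<Rightarrow> 'b list \<Rightarrow>\<^sub>0 int" where
  "through x = (SOME c. walk_chain X (\<phi>X (\<pi> x)) x (the_enat (ddist X (\<phi>X (\<pi> x)) x)) c)"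

text \<open>
  Up to null chains, every short walk from \<open>A\<close> to \<open>x\<close> runs inside \<open>A\<close> to \<open>\<pi> x\<close> and continues along
  the chosen geodesic.  The metric conditions on the retraction enter here.
\<close>

lemma walk_through:
  assumes w: "walk_chain X (\<phi>X a) x m c" and a: "a \<in> pverts A" and m: "m \<le> s"
  shows "\<exists>k d. k \<le> m \<and> walk_chain A a (\<pi> x) k d \<and> c - (rc_map \<phi>X d + through x) \<in> walk_null s X"
proof -
  note inA = digraph_mapD(1) [OF \<phi>X]
  obtain m' where m': "ddist X (\<phi>X a) x = enat m'" "m' \<le> m"
    using ddist_le [OF w] by (metis enat_ile enat_ord_simps(1))
  then obtain k l where kl: "\<pi> x \<in> pverts A" "ddist X (\<phi>X a) (\<phi>X (\<pi> x)) = enat k"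
    "ddist X (\<phi>X (\<pi> x)) x = enat l" "k \<le> m'" "k + l \<le> s"
    using \<pi> [OF a walk_chain_verts(2) [OF w loopX] m'(1)] m by auto
  have l: "walk_chain X (\<phi>X (\<pi> x)) x l (through x)"
    unfolding through_def using someI_ex [OF ddist_geodesic [OF kl(3) inA [OF kl(1)]]] kl(3) by simp
  \<comment> \<open>A geodesic between two points of A cannot leave A, since it could not come back.\<close>
  obtain c' where c': "walk_chain X (\<phi>X a) (\<phi>X (\<pi> x)) k c'"
    using ddist_geodesic [OF kl(2) inA [OF a]] by blast
  then obtain a' b' d where d: "\<phi>X a = \<phi>X a'" "\<phi>X (\<pi> x) = \<phi>X b'" "walk_chain A a' b' k d" "c' = rc_map \<phi>X d"
    using walk_in_A kl(1) by blast
  then have "a' = a" "b' = \<pi> x"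
    using induced a kl(1) walk_chain_verts [OF d(3) loopA] by (auto simp: induced_inclusion_def inj_on_def)
  moreover have "c - (c' + through x) \<in> walk_null s X"
    by (rule walk_null.walks [OF w walk_chain_append [OF l c'] m kl(5)])
  ultimately show ?thesis using d kl m' by (intro exI [of _ k] exI [of _ d]) auto
qed

text \<open>
  Nothing returns from the part of \<open>X\<close> outside \<open>A\<close>.  A walk in the pushout therefore stays in \<open>Y\<close>,
  stays outside \<open>A\<close>, or consists of a walk in \<open>Y\<close> up to some \<open>\<phi>Y a\<close> followed by a walk in \<open>X\<close> from
  \<open>\<phi>X a\<close>.  The point \<open>a\<close> where the walk crosses over may be different for walks with the same end
  points.
\<close>

lemma walk_split:
  assumes "walk_chain P p q n c"
  obtains (Y) y y' cY where "p = jY y" "q = jY y'" "walk_chain Y y y' n cY" "c = rc_map jY cY"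
  | (X) x x' cX where "p = jX x" "q = jX x'" "x \<notin> AX" "x' \<notin> AX" "walk_chain X x x' n cX"
      "c = rc_map jX cX"
  | (cross) y a x l m cY cX where "p = jY y" "q = jX x" "a \<in> pverts A" "x \<notin> AX"
      "walk_chain Y y (\<phi>Y a) l cY" "walk_chain X (\<phi>X a) x m cX" "l + m = n"
      "c = rc_map jY cY + rc_map jX cX"
proof -
  let ?Y = "\<lambda>p q n c. \<exists>y y' cY. p = jY y \<and> q = jY y' \<and> walk_chain Y y y' n cY \<and> c = rc_map jY cY"
  let ?X = "\<lambda>p q n c. \<exists>x x' cX. p = jX x \<and> q = jX x' \<and> x \<notin> AX \<and> x' \<notin> AX \<and>
    walk_chain X x x' n cX \<and> c = rc_map jX cX"
  let ?C = "\<lambda>p q n c. \<exists>y a x l m cY cX. p = jY y \<and> q = jX x \<and> a \<in> pverts A \<and> x \<notin> AX \<and>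
    walk_chain Y y (\<phi>Y a) l cY \<and> walk_chain X (\<phi>X a) x m cX \<and> l + m = n \<and>
    c = rc_map jY cY + rc_map jX cX"
  interpret P: pair_loopfree_digraph P by (rule loopP)
  have "?Y p q n c \<or> ?X p q n c \<or> ?C p q n c"
    using assms
  proof (induction rule: walk_chain.induct)
    case (Nil p)
    then consider x where "p = jX x" "x \<in> pverts X" | y where "p = jY y" "y \<in> pverts Y"
      using verts by blast
    then show ?case
    proof cases
      case (1 x)
      show ?thesis
      proof (cases "x \<in> AX")
        case True
        then obtain a where "a \<in> pverts A" "x = \<phi>X a" by auto
        then have "?Y p p 0 0"
          using 1 glue digraph_mapD(1) [OF \<phi>Y] walk_chain.Nil by (force simp: rc_map_simps)
        then show ?thesis ..
      next
        case False
        then have "?X p p 0 0" using 1 walk_chain.Nil by (force simp: rc_map_simps)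
        then show ?thesis by blast
      qed
    next
      case (2 y)
      then have "?Y p p 0 0" using walk_chain.Nil by (force simp: rc_map_simps)
      then show ?thesis ..
    qed
  next
    case (Snoc p q n c q')
    have qq': "q \<noteq> q'" using P.pair_no_loops [OF Snoc(2)] by simp
    from Snoc.IH consider "?Y p q n c" | "?X p q n c" | "?C p q n c" by blast
    then show ?case
    proof cases
      case 1
      then obtain y y' cY where i: "p = jY y" "q = jY y'" "walk_chain Y y y' n cY" "c = rc_map jY cY"
        by blast
      show ?thesis using Snoc(2)
      proof (cases rule: edges_cases)
        case (Y y1 y2)
        then have e: "(y', y2) \<in> parcs Y" using i jY_eq by auto
        have "?Y p q' (Suc n) (c + frag_of [q, q'])"
          using walk_chain.Snoc [OF i(3) e] i Y qq'
          by (intro exI [of _ y] exI [of _ y2] exI [of _ "cY + frag_of [y', y2]"])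
             (auto simp: rc_map_simps)
        then show ?thesis ..
      next
        case (X x1 x2)
        then obtain a where a: "a \<in> pverts A" "x1 = \<phi>X a" "y' = \<phi>Y a"
          using jX_jY_eq i by metis
        have "?C p q' (Suc n) (c + frag_of [q, q'])"
          using walk_chain_edge [OF loopX X(1)] i X qq' a
          by (intro exI [of _ y] exI [of _ a] exI [of _ x2] exI [of _ n] exI [of _ 1]
              exI [of _ cY] exI [of _ "frag_of [x1, x2]"]) auto
        then show ?thesis by blast
      qed
    next
      case 2
      then obtain x x' cX where i: "p = jX x" "q = jX x'" "x \<notin> AX" "x' \<notin> AX"
        "walk_chain X x x' n cX" "c = rc_map jX cX"
        by blast
      show ?thesis using Snoc(2)
      proof (cases rule: edges_cases)
        case (Y y1 y2)
        then show ?thesis using i jX_jY_eq by (metis imageI)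
      next
        case (X x1 x2)
        then have e: "(x', x2) \<in> parcs X" using i jX_eq by metis
        have "?X p q' (Suc n) (c + frag_of [q, q'])"
          using walk_chain.Snoc [OF i(5) e] i X qq'
          by (intro exI [of _ x] exI [of _ x2] exI [of _ "cX + frag_of [x', x2]"])
             (auto simp: rc_map_simps)
        then show ?thesis by blast
      qed
    next
      case 3
      then obtain y a x l m cY cX where i: "p = jY y" "q = jX x" "a \<in> pverts A" "x \<notin> AX"
        "walk_chain Y y (\<phi>Y a) l cY" "walk_chain X (\<phi>X a) x m cX" "l + m = n"
        "c = rc_map jY cY + rc_map jX cX" by blast
      show ?thesis using Snoc(2)
      proof (cases rule: edges_cases)
        case (Y y1 y2)
        then show ?thesis using i jX_jY_eq by (metis imageI)
      next
        case (X x1 x2)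
        then have e: "(x, x2) \<in> parcs X" using i jX_eq by metis
        have "?C p q' (Suc n) (c + frag_of [q, q'])"
          using walk_chain.Snoc [OF i(6) e] i X qq'
          by (intro exI [of _ y] exI [of _ a] exI [of _ x2] exI [of _ l] exI [of _ "Suc m"]
              exI [of _ cY] exI [of _ "cX + frag_of [x, x2]"])
             (auto simp: rc_map_simps)
        then show ?thesis by blast
      qed
    qed
  qed
  then show thesis using Y X cross by blast
qed

definition null_images :: "('d list \<Rightarrow>\<^sub>0 int) set" where
  "null_images = {rc_map jX u + rc_map jY v | u v. u \<in> walk_null s X \<and> v \<in> walk_null s Y}"

lemma add_closed_null_images: "add_closed null_images"
proof -
  have "0 \<in> null_images"
    unfolding null_images_def
    by (intro CollectI exI [of _ 0]) (simp add: rc_map_simps walk_null.zero)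
  moreover have "c - d \<in> null_images" if cd: "c \<in> null_images" "d \<in> null_images" for c d
  proof -
    obtain u v u' v' where "u \<in> walk_null s X" "v \<in> walk_null s Y" "c = rc_map jX u + rc_map jY v"
      "u' \<in> walk_null s X" "v' \<in> walk_null s Y" "d = rc_map jX u' + rc_map jY v'"
      using cd unfolding null_images_def by blast
    then show ?thesis
      unfolding null_images_def
      by (intro CollectI exI [of _ "u - u'"] exI [of _ "v - v'"])
         (auto simp: rc_map_simps intro: walk_null.diff)
  qed
  ultimately show ?thesis by (auto simp: add_closed_def)
qed

lemma in_null_images:
  "u \<in> walk_null s X \<Longrightarrow> rc_map jX u \<in> null_images"
  "v \<in> walk_null s Y \<Longrightarrow> rc_map jY v \<in> null_images"
  unfolding null_images_def using walk_null.zero by (force simp: rc_map_simps)+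

text \<open>
  Every crossing walk can be rerouted to cross over at \<open>\<pi> x\<close>.  The part inside \<open>A\<close> that this
  produces is moved to \<open>Y\<close>; the walk in \<open>Y\<close> stays short because \<open>\<pi> x\<close> is no farther from \<open>a\<close>
  than \<open>x\<close>.
\<close>

lemma cross_normal_form:
  assumes "a \<in> pverts A" "walk_chain Y y (\<phi>Y a) l cY" "walk_chain X (\<phi>X a) x m cX" "l + m \<le> s"
  shows "\<exists>n d. n \<le> s \<and> walk_chain Y y (\<phi>Y (\<pi> x)) n d \<and>
    rc_map jY cY + rc_map jX cX - (rc_map jY d + rc_map jX (through x)) \<in> null_images"
proof -
  obtain k d where d: "k \<le> m" "walk_chain A a (\<pi> x) k d"
    "cX - (rc_map \<phi>X d + through x) \<in> walk_null s X"
    using walk_through [OF assms(3,1)] assms(4) by auto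
  obtain k' where k': "k' \<le> k" "walk_chain Y (\<phi>Y a) (\<phi>Y (\<pi> x)) k' (rc_map \<phi>Y d)"
    using walk_chain_map [OF d(2) \<phi>Y] by auto
  have "rc_map jX (cX - (rc_map \<phi>X d + through x)) \<in> null_images"
    by (rule in_null_images(1) [OF d(3)])
  moreover have "rc_map jX (cX - (rc_map \<phi>X d + through x)) =
    rc_map jY cY + rc_map jX cX - (rc_map jY (cY + rc_map \<phi>Y d) + rc_map jX (through x))"
    using glue_edge [OF walk_chain_in_edge_chains [OF d(2)]] by (simp add: rc_map_simps)
  ultimately show ?thesis
    using walk_chain_append [OF k'(2) assms(2)] d k' assms(4)
    by (intro exI [of _ "l + k'"] exI [of _ "cY + rc_map \<phi>Y d"]) auto
qed

text \<open>
  Relations in the pushout come from relations in \<open>X\<close> and in \<open>Y\<close>.  Walks of the two kinds that do not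
  cross over lift directly.  Two crossing walks with common end points are rerouted to cross over at
  the same point and to end with the same geodesic, so that they differ by two walks in \<open>Y\<close>.
\<close>

lemma walk_null_pushout:
  assumes "c \<in> walk_null s P" shows "c \<in> null_images"
proof (rule walk_null_in [OF add_closed_null_images additive_ident _ assms])
  fix p q m c n d
  assume w: "walk_chain P p q m c" "walk_chain P p q n d" and mn: "m \<le> s" "n \<le> s"
  show "c - d \<in> null_images"
    using w(1)
  proof (cases rule: walk_split)
    case c: (Y y y' cY)
    from w(2) show ?thesis
    proof (cases rule: walk_split)
      case (Y z z' dY)
      then have "cY - dY \<in> walk_null s Y"
        using c mn jY_eq walk_null.walks by metis
      then show ?thesis using in_null_images(2) c Y by (force simp: rc_map_simps)
    qed (use c jX_jY_eq in \<open>metis imageI\<close>)+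
  next
    case c: (X x x' cX)
    from w(2) show ?thesis
    proof (cases rule: walk_split)
      case (X z z' dX)
      then have "cX - dX \<in> walk_null s X"
        using c mn jX_eq walk_null.walks by metis
      then show ?thesis using in_null_images(1) c X by (force simp: rc_map_simps)
    qed (use c jX_jY_eq in \<open>metis imageI\<close>)+
  next
    case c: (cross y a x l k cY cX)
    from w(2) show ?thesis
    proof (cases rule: walk_split)
      case d: (cross y' a' x' l' k' dY dX)
      have eq: "y' = y" "x' = x" using c d jY_eq jX_eq by metis+
      obtain i u where u: "i \<le> s" "walk_chain Y y (\<phi>Y (\<pi> x)) i u"
        "c - (rc_map jY u + rc_map jX (through x)) \<in> null_images"
        using cross_normal_form [OF c(3,5,6)] c mn by auto
      obtain j v where v: "j \<le> s" "walk_chain Y y (\<phi>Y (\<pi> x)) j v"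
        "d - (rc_map jY v + rc_map jX (through x)) \<in> null_images"
        using cross_normal_form [OF d(3,5,6)] d eq mn by auto
      have "rc_map jY (u - v) \<in> null_images"
        by (rule in_null_images(2) [OF walk_null.walks [OF u(2) v(2) u(1) v(1)]])
      then have "(c - (rc_map jY u + rc_map jX (through x))) -
          (d - (rc_map jY v + rc_map jX (through x))) + rc_map jY (u - v) \<in> null_images"
        using add_closedD(4) [OF add_closed_null_images
          add_closedD(2) [OF add_closed_null_images u(3) v(3)]] by blast
      then show ?thesis by (simp add: rc_map_simps)
    qed (use c jX_jY_eq in \<open>metis imageI\<close>)+
  qed
qed

end

context cofibration_gluing
begin

definition iA :: "'b \<Rightarrow> 'a" where "iA = inv_into (pverts A) \<phi>X"
definition iX :: "'d \<Rightarrow> 'b" where "iX = inv_into (- AX) jX"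
definition iY :: "'d \<Rightarrow> 'c" where "iY = inv_into UNIV jY"

lemma iA [simp]: "a \<in> pverts A \<Longrightarrow> iA (\<phi>X a) = a"
  using induced by (simp add: iA_def induced_inclusion_def)

lemma iX [simp]: "x \<notin> AX \<Longrightarrow> iX (jX x) = x"
  unfolding iX_def by (rule inv_into_f_f) (auto simp: inj_on_def intro: jX_eq)

lemma iY [simp]: "iY (jY y) = y"
  unfolding iY_def by (rule inv_f_f) (auto simp: inj_on_def intro: jY_eq)

lemma jX_in_range: "jX x \<in> range jY \<longleftrightarrow> x \<in> AX"
  using jX_jY_eq glue by blast

text \<open>
  Three linear maps that decompose a chain of edges of \<open>X\<close>, given on the edge from \<open>x\<close> to \<open>y\<close>:
  \<open>push_edge\<close> keeps an edge inside \<open>A\<close> and retracts an edge leaving \<open>A\<close> along \<open>\<pi>\<close>; \<open>outer_edge\<close>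
  supplies what is lost, namely the geodesic from \<open>\<pi> y\<close> to \<open>y\<close> or the edge itself when it lies
  outside \<open>A\<close>; \<open>inner_edge\<close> is the image of \<open>push_edge\<close> in \<open>Y\<close>.  The last two depend only on the
  image of the edge in the pushout and are therefore defined there.
\<close>

definition push_edge :: "('b list \<Rightarrow>\<^sub>0 int) \<Rightarrow> ('a list \<Rightarrow>\<^sub>0 int)" where
  "push_edge = frag_extend (\<lambda>xs. let x = hd xs; y = last xs in
     if x \<in> AX then rc_of [iA x, if y \<in> AX then iA y else \<pi> y] else 0)"

definition outer_edge :: "('d list \<Rightarrow>\<^sub>0 int) \<Rightarrow> ('b list \<Rightarrow>\<^sub>0 int)" where
  "outer_edge = frag_extend (\<lambda>ps. let p = hd ps; q = last ps in
     if q \<in> range jY then 0 else if p \<in> range jY then through (iX q) else rc_of [iX p, iX q])"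

definition inner_edge :: "('d list \<Rightarrow>\<^sub>0 int) \<Rightarrow> ('c list \<Rightarrow>\<^sub>0 int)" where
  "inner_edge = frag_extend (\<lambda>ps. let p = hd ps; q = last ps in
     if p \<in> range jY then rc_of [iY p, if q \<in> range jY then iY q else \<phi>Y (\<pi> (iX q))] else 0)"

lemma additive_edge_maps:
  "Modules.additive push_edge" "Modules.additive outer_edge" "Modules.additive inner_edge"
  unfolding push_edge_def outer_edge_def inner_edge_def by (rule additive_frag_extend)+

lemma edge_maps_of:
  shows push_edge_of: "push_edge (frag_of [x, y]) =
      (if x \<in> AX then rc_of [iA x, if y \<in> AX then iA y else \<pi> y] else 0)"
    and outer_edge_of: "outer_edge (frag_of [p, q]) =
      (if q \<in> range jY then 0 else if p \<in> range jY then through (iX q) else rc_of [iX p, iX q])"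
    and inner_edge_of: "inner_edge (frag_of [p, q]) =
      (if p \<in> range jY then rc_of [iY p, if q \<in> range jY then iY q else \<phi>Y (\<pi> (iX q))] else 0)"
  by (simp_all add: push_edge_def outer_edge_def inner_edge_def Let_def del: rc_of_small)

text \<open>
  The bound \<open>d(a, \<pi> y) \<le> d(a, y) = 1\<close> makes the retracted edge an edge of \<open>A\<close> or degenerate.
\<close>

lemma push_edge_leaving:
  assumes "(\<phi>X a, y) \<in> parcs X" "a \<in> pverts A" "y \<notin> AX"
  shows "rc_of [a, \<pi> y] \<in> edge_chains A"
    and "frag_of [\<phi>X a, y] - (rc_map \<phi>X (rc_of [a, \<pi> y]) + through y) \<in> walk_null s X"
proof -
  obtain k d where d: "k \<le> 1" "walk_chain A a (\<pi> y) k d"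
    "frag_of [\<phi>X a, y] - (rc_map \<phi>X d + through y) \<in> walk_null s X"
    using walk_through [OF walk_chain_edge [OF loopX assms(1)] assms(2) s] by blast
  have "d = rc_of [a, \<pi> y]" using walk_chain_le_1 [OF d(2,1) loopA] .
  then show "rc_of [a, \<pi> y] \<in> edge_chains A"
    and "frag_of [\<phi>X a, y] - (rc_map \<phi>X (rc_of [a, \<pi> y]) + through y) \<in> walk_null s X"
    using d walk_chain_in_edge_chains by metis+
qed

lemma edge_X_cases:
  assumes "(x, y) \<in> parcs X"
  obtains (inside) a b where "x = \<phi>X a" "y = \<phi>X b" "a \<in> pverts A" "b \<in> pverts A" "(a, b) \<in> parcs A"
  | (leaving) a where "x = \<phi>X a" "a \<in> pverts A" "y \<notin> AX"
  | (outside) "x \<notin> AX" "y \<notin> AX"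
  using assms edge_in_A by blast

lemma push_edge_chain:
  assumes "u \<in> edge_chains X" shows "push_edge u \<in> edge_chains A"
proof (rule edge_chains_image [OF assms add_closed_chains(2) additive_edge_maps(1)])
  fix x y assume e: "(x, y) \<in> parcs X"
  interpret A: pair_loopfree_digraph A by (rule loopA)
  from e show "push_edge (frag_of [x, y]) \<in> edge_chains A"
    by (cases rule: edge_X_cases)
       (use e push_edge_leaving(1) in \<open>auto simp: push_edge_of dest: A.pair_no_loops
          intro: add_closedD(1) [OF add_closed_chains(2)]\<close>)
qed

lemma push_edge_homologous:
  assumes "u \<in> edge_chains X"
  shows "u - (rc_map \<phi>X (push_edge u) + outer_edge (rc_map jX u)) \<in> walk_null s X"
proof -
  interpret X: pair_loopfree_digraph X by (rule loopX)
  note add = additive_edge_maps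
  have "Modules.additive (\<lambda>u. u - (rc_map \<phi>X (push_edge u) + outer_edge (rc_map jX u)))"
    by (rule additive.intro)
       (simp add: rc_map_simps additive.add [OF add(1)] additive.add [OF add(2)])
  with assms add_closed_walk_null show ?thesis
  proof (rule edge_chains_image)
    fix x y assume e: "(x, y) \<in> parcs X"
    then have ne: "x \<noteq> y" using X.pair_no_loops by force
    from e show "frag_of [x, y] - (rc_map \<phi>X (push_edge (frag_of [x, y])) +
        outer_edge (rc_map jX (frag_of [x, y]))) \<in> walk_null s X"
    proof (cases rule: edge_X_cases)
      case (inside a b)
      then have "outer_edge (rc_of [jX x, jX y]) = 0"
        using jX_in_range [of y] by (simp add: outer_edge_of additive.zero [OF add(2)])
      then show ?thesis
        using inside ne by (auto simp: push_edge_of walk_null.zero)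
    next
      case (leaving a)
      have "jX x \<noteq> jX y" using leaving jX_eq [of y x] by auto
      then have "outer_edge (rc_of [jX x, jX y]) = through y"
        using leaving jX_in_range [of x] jX_in_range [of y] by (simp add: outer_edge_of)
      moreover have "push_edge (frag_of [x, y]) = rc_of [a, \<pi> y]"
        using leaving by (simp add: push_edge_of del: rc_of_small)
      ultimately show ?thesis
        using push_edge_leaving(2) [of a y] e leaving by (simp del: rc_of_small)
    next
      case outside
      have "jX x \<noteq> jX y" using outside jX_eq [of y x] ne by auto
      then have "outer_edge (rc_of [jX x, jX y]) = frag_of [x, y]"
        using outside ne jX_in_range [of x] jX_in_range [of y] by (simp add: outer_edge_of)
      then show ?thesis
        using outside by (simp add: push_edge_of walk_null.zero additive.zero [OF additive_rc_map])
    qed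
  qed
qed

lemma push_edge_inner:
  assumes "u \<in> edge_chains X"
  shows "rc_map \<phi>Y (push_edge u) = inner_edge (rc_map jX u)"
proof (rule edge_chains_eqI [OF assms])
  interpret A: pair_loopfree_digraph A by (rule loopA)
  note add = additive_edge_maps
  fix x y assume e: "(x, y) \<in> parcs X"
  from e show "rc_map \<phi>Y (push_edge (frag_of [x, y])) = inner_edge (rc_map jX (frag_of [x, y]))"
  proof (cases rule: edge_X_cases)
    case (inside a b)
    have "a \<noteq> b" using A.pair_no_loops [OF inside(5)] by simp
    moreover have "jY (\<phi>Y a) = jY (\<phi>Y b) \<longleftrightarrow> \<phi>Y a = \<phi>Y b" by (metis jY_eq)
    moreover have "jX x = jY (\<phi>Y a)" "jX y = jY (\<phi>Y b)" using inside glue by simp_all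
    ultimately show ?thesis
      using inside by (simp add: push_edge_of inner_edge_of additive.zero [OF add(3)])
  next
    case (leaving a)
    have "jX x \<noteq> jX y" using leaving jX_eq [of y x] by auto
    moreover have "jX x = jY (\<phi>Y a)" using leaving glue by simp
    ultimately show ?thesis
      using leaving jX_in_range [of y]
      by (simp add: push_edge_of inner_edge_of additive.zero [OF additive_rc_map])
  next
    case outside
    then show ?thesis
      using jX_in_range [of x]
      by (simp add: push_edge_of inner_edge_of additive.zero [OF add(3)] additive.zero [OF additive_rc_map])
  qed
qed (rule additive_comp [OF additive_rc_map additive_edge_maps(1)]
    additive_comp [OF additive_edge_maps(3) additive_rc_map])+

lemma edge_maps_Y:
  assumes "v \<in> edge_chains Y"
  shows "outer_edge (rc_map jY v) = 0" "inner_edge (rc_map jY v) = v"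
proof -
  interpret Y: pair_loopfree_digraph Y by (rule loopY)
  note add = additive_edge_maps
  have ne: "jY x \<noteq> jY y" "x \<noteq> y" if "(x, y) \<in> parcs Y" for x y
    using Y.pair_no_loops [OF that] jY_eq by auto
  have outer: "outer_edge (rc_map jY (frag_of [x, y])) = 0" if "(x, y) \<in> parcs Y" for x y
    using ne [OF that] by (simp add: outer_edge_of)
  have inner: "inner_edge (rc_map jY (frag_of [x, y])) = frag_of [x, y]" if "(x, y) \<in> parcs Y" for x y
    using ne [OF that] by (simp add: inner_edge_of)
  show "outer_edge (rc_map jY v) = 0"
    by (rule edge_chains_eqI [OF assms additive_comp [OF add(2) additive_rc_map] additive_const_0 outer])
  show "inner_edge (rc_map jY v) = v"
    by (rule edge_chains_eqI [OF assms additive_comp [OF add(3) additive_rc_map] additive_ident inner])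
qed

lemma rc_map_\<phi>X_zero:
  assumes "d \<in> vertex_chains (pverts A)" "rc_map \<phi>X d = 0" shows "d = 0"
proof -
  have "rc_map iA (rc_map \<phi>X d) = d"
    by (rule vertex_chains_eqI [OF assms(1)])
       (auto intro!: additive_chain_maps)
  then show ?thesis using assms(2) by (simp add: rc_map_simps)
qed

text \<open>
  After correcting \<open>u\<close> and \<open>v\<close> by null chains, their images in the pushout agree as chains of edges.
  Then \<open>w = push_edge u\<close> works: its defect \<open>outer_edge\<close> and its image \<open>inner_edge\<close> are computed from
  the image of \<open>u\<close>, hence from that of \<open>v\<close>, where they are \<open>0\<close> and \<open>v\<close> itself.
\<close>

lemma exact_middle:
  assumes u: "u \<in> edge_cycles X" and v: "v \<in> edge_cycles Y"
    and null: "rc_map jX u - rc_map jY v \<in> walk_null s P"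
  shows "\<exists>w \<in> edge_cycles A. u - rc_map \<phi>X w \<in> walk_null s X \<and> v - rc_map \<phi>Y w \<in> walk_null s Y"
proof -
  obtain n m where nm: "n \<in> walk_null s X" "m \<in> walk_null s Y"
    "rc_map jX u - rc_map jY v = rc_map jX n + rc_map jY m"
    using walk_null_pushout [OF null] by (auto simp: null_images_def)
  define u' v' where "u' = u - n" and "v' = v + m"
  have eq: "rc_map jX u' = rc_map jY v'"
    using nm(3) by (simp add: u'_def v'_def rc_map_simps algebra_simps)
  have cyc: "u' \<in> edge_cycles X" "v' \<in> edge_cycles Y"
    unfolding u'_def v'_def using nm u v walk_null_subset_cycles
    by (blast intro: add_closedD [OF add_closed_chains(3)])+
  then have ch: "u' \<in> edge_chains X" "v' \<in> edge_chains Y" by (auto simp: edge_cycles_def)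
  define w where "w = push_edge u'"
  have w: "w \<in> edge_chains A" unfolding w_def by (rule push_edge_chain [OF ch(1)])
  have null': "u' - rc_map \<phi>X w \<in> walk_null s X"
    using push_edge_homologous [OF ch(1)] by (simp add: eq edge_maps_Y(1) [OF ch(2)] w_def)
  have v'w: "v' = rc_map \<phi>Y w"
    using push_edge_inner [OF ch(1)] by (simp add: eq edge_maps_Y(2) [OF ch(2)] w_def)
  have "rc_boundary (u' - rc_map \<phi>X w) = 0" "rc_boundary u' = 0"
    using null' walk_null_subset_cycles cyc by (auto simp: edge_cycles_def)
  then have "rc_map \<phi>X (rc_boundary w) = 0"
    by (simp add: rc_boundary_simps rc_map_boundary [OF w])
  then have "w \<in> edge_cycles A"
    using w rc_map_\<phi>X_zero rc_boundary_edge_chain [OF loopA w] by (simp add: edge_cycles_def)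
  moreover have "u - rc_map \<phi>X w \<in> walk_null s X"
    using add_closedD(4) [OF add_closed_walk_null null' nm(1)] by (simp add: u'_def algebra_simps)
  moreover have "v - rc_map \<phi>Y w \<in> walk_null s Y"
    using add_closedD(3) [OF add_closed_walk_null nm(2)] by (simp add: v'w [symmetric] v'_def)
  ultimately show ?thesis by blast
qed

section \<open>Surjectivity\<close>

lemma lift_edge_chain:
  assumes "c \<in> edge_chains P"
  shows "\<exists>u \<in> edge_chains X. \<exists>v \<in> edge_chains Y. c = rc_map jX u - rc_map jY v"
proof -
  let ?L = "{rc_map jX u - rc_map jY v | u v. u \<in> edge_chains X \<and> v \<in> edge_chains Y}"
  note Z = add_closedD [OF add_closed_chains(2)]
  have L: "add_closed ?L"
    unfolding add_closed_def
  proof (intro conjI ballI)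
    show "0 \<in> ?L" by (intro CollectI exI [of _ 0]) (simp add: rc_map_simps Z(1))
    fix c d assume "c \<in> ?L" "d \<in> ?L"
    then obtain u v u' v' where "u \<in> edge_chains X" "v \<in> edge_chains Y"
      "u' \<in> edge_chains X" "v' \<in> edge_chains Y"
      "c = rc_map jX u - rc_map jY v" "d = rc_map jX u' - rc_map jY v'" by blast
    then show "c - d \<in> ?L"
      by (intro CollectI exI [of _ "u - u'"] exI [of _ "v - v'"]) (auto simp: rc_map_simps Z)
  qed
  have "c \<in> ?L"
    using assms L additive_ident
  proof (rule edge_chains_image)
    fix p q assume pq: "(p, q) \<in> parcs P"
    then have ne: "p \<noteq> q" using edges by blast
    from pq show "frag_of [p, q] \<in> ?L"
    proof (cases rule: edges_cases)
      case (Y y y')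
      then show ?thesis
        using ne by (intro CollectI exI [of _ 0] exI [of _ "- frag_of [y, y']"]) (auto simp: rc_map_simps Z)
    next
      case (X x x')
      then show ?thesis
        using ne by (intro CollectI exI [of _ "frag_of [x, x']"] exI [of _ 0]) (auto simp: rc_map_simps Z)
    qed
  qed
  then show ?thesis by blast
qed

end

text \<open>
  In a connected graph every vertex chain is homologous to a multiple of one vertex.  The constant
  map at that vertex serves as augmentation: it sends \<open>d\<close> to the sum of its coefficients times \<open>a\<close>.
\<close>

lemma connected_vertex_chain:
  assumes A: "pair_loopfree_digraph A" and conn: "zigzag_connected A" and a: "a \<in> pverts A"
    and d: "d \<in> vertex_chains (pverts A)"
  shows "\<exists>w \<in> edge_chains A. d = rc_map (\<lambda>_. a) d + rc_boundary w"
proof -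
  note Z = add_closedD [OF add_closed_chains(2)]
  have step: "\<exists>w \<in> edge_chains A. frag_of [b] = frag_of [a] + rc_boundary w" if "b \<in> pverts A" for b
  proof -
    have "(a, b) \<in> (parcs A \<union> (parcs A)\<inverse>)\<^sup>*" using conn a that by (auto simp: zigzag_connected_def)
    then show ?thesis
    proof (induction rule: rtrancl_induct)
      case base
      then show ?case using Z(1) by (intro bexI [of _ 0]) (auto simp: rc_boundary_simps)
    next
      case (step y z)
      then obtain w where w: "w \<in> edge_chains A" "frag_of [y] = frag_of [a] + rc_boundary w" by blast
      from step(2) consider "(y, z) \<in> parcs A" | "(z, y) \<in> parcs A" by blast
      then show ?case
      proof cases
        case 1
        then have "w + frag_of [y, z] \<in> edge_chains A" using w by (intro Z) simp_all
        then show ?thesis using w by (intro bexI) (auto simp: rc_boundary_simps rc_boundary_small)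
      next
        case 2
        then have "w - frag_of [z, y] \<in> edge_chains A" using w by (intro Z) simp_all
        then show ?thesis using w by (intro bexI) (auto simp: rc_boundary_simps rc_boundary_small)
      qed
    qed
  qed
  have closed: "add_closed (rc_boundary ` edge_chains A)"
    unfolding add_closed_def
  proof (intro conjI ballI)
    show "0 \<in> rc_boundary ` edge_chains A"
      by (rule image_eqI [OF _ Z(1)]) (simp add: rc_boundary_simps)
    fix c d assume "c \<in> rc_boundary ` edge_chains A" "d \<in> rc_boundary ` edge_chains A"
    then obtain u v where "u \<in> edge_chains A" "v \<in> edge_chains A" "c = rc_boundary u" "d = rc_boundary v"
      by blast
    then show "c - d \<in> rc_boundary ` edge_chains A"
      by (intro image_eqI [of _ _ "u - v"]) (simp_all add: rc_boundary_simps Z(2))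
  qed
  have "d - rc_map (\<lambda>_. a) d \<in> rc_boundary ` edge_chains A"
  proof (rule vertex_chains_image [OF d closed])
    show "Modules.additive (\<lambda>d. d - rc_map (\<lambda>_. a) d)"
      by (rule additive.intro) (simp add: rc_map_simps)
    fix b assume "b \<in> pverts A"
    then obtain w where "w \<in> edge_chains A" "frag_of [b] = frag_of [a] + rc_boundary w"
      using step by blast
    then have "w \<in> edge_chains A" "rc_boundary w = frag_of [b] - frag_of [a]"
      by simp_all
    then show "frag_of [b] - rc_map (\<lambda>_. a) (frag_of [b]) \<in> rc_boundary ` edge_chains A"
      by (intro image_eqI [of _ _ w]) simp_all
  qed
  then obtain w where "w \<in> edge_chains A" "d - rc_map (\<lambda>_. a) d = rc_boundary w" by blast
  then show ?thesis by (intro bexI [of _ w]) (simp_all add: algebra_simps)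
qed

context cofibration_gluing
begin

text \<open>
  Vertices of \<open>X\<close> outside \<open>A\<close> are not identified with anything, so a vertex chain of \<open>X\<close> whose image
  comes from \<open>Y\<close> is supported on \<open>A\<close>.  In the proof, \<open>\<rho>\<close> reads off the part outside \<open>A\<close> from
  the image in the pushout, and \<open>\<sigma>\<close> the part in \<open>Y\<close>.
\<close>

lemma boundary_lives_on_A:
  assumes d: "d \<in> vertex_chains (pverts X)" and e: "e \<in> vertex_chains (pverts Y)"
    and eq: "rc_map jX d = rc_map jY e"
  shows "\<exists>b \<in> vertex_chains (pverts A). rc_map \<phi>X b = d \<and> rc_map \<phi>Y b = e"
proof -
  define \<kappa> where "\<kappa> = frag_extend (\<lambda>xs. if hd xs \<in> AX then frag_of [iA (hd xs)] else 0)"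
  define \<rho> where "\<rho> = frag_extend (\<lambda>ps. if hd ps \<in> range jY then 0 else frag_of [iX (hd ps)])"
  define \<sigma> where "\<sigma> = frag_extend (\<lambda>ps. if hd ps \<in> range jY then frag_of [iY (hd ps)] else 0)"
  have add: "Modules.additive \<kappa>" "Modules.additive \<rho>" "Modules.additive \<sigma>"
    unfolding \<kappa>_def \<rho>_def \<sigma>_def by (rule additive_frag_extend)+
  have "\<kappa> d \<in> vertex_chains (pverts A)"
    using d add_closed_chains(1) add(1)
    by (rule vertex_chains_image)
       (auto simp: \<kappa>_def intro: add_closedD(1) [OF add_closed_chains(1)])
  moreover have "rc_map \<phi>X (\<kappa> d) + \<rho> (rc_map jX d) = d"
  proof (rule vertex_chains_eqI [OF d _ additive_ident])
    show "Modules.additive (\<lambda>d. rc_map \<phi>X (\<kappa> d) + \<rho> (rc_map jX d))"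
      by (intro additive_plus additive_comp [OF additive_rc_map add(1)]
          additive_comp [OF add(2) additive_rc_map])
    show "rc_map \<phi>X (\<kappa> (frag_of [x])) + \<rho> (rc_map jX (frag_of [x])) = frag_of [x]" for x
    proof (cases "x \<in> AX")
      case True
      then obtain a where "a \<in> pverts A" "x = \<phi>X a" by blast
      then show ?thesis using glue [of a] by (simp add: \<kappa>_def \<rho>_def)
    next
      case False
      then show ?thesis using jX_in_range [of x] by (simp add: \<kappa>_def \<rho>_def rc_map_simps)
    qed
  qed
  moreover have "\<rho> (rc_map jY e) = 0"
    by (rule vertex_chains_eqI [OF e additive_comp [OF add(2) additive_rc_map] additive_const_0])
       (simp add: \<rho>_def)
  moreover have "rc_map \<phi>Y (\<kappa> d) = \<sigma> (rc_map jX d)"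
  proof (rule vertex_chains_eqI [OF d additive_comp [OF additive_rc_map add(1)]
        additive_comp [OF add(3) additive_rc_map]])
    show "rc_map \<phi>Y (\<kappa> (frag_of [x])) = \<sigma> (rc_map jX (frag_of [x]))" for x
    proof (cases "x \<in> AX")
      case True
      then obtain a where "a \<in> pverts A" "x = \<phi>X a" by blast
      then show ?thesis using glue [of a] by (simp add: \<kappa>_def \<sigma>_def)
    next
      case False
      then show ?thesis using jX_in_range [of x] by (simp add: \<kappa>_def \<sigma>_def rc_map_simps)
    qed
  qed
  moreover have "\<sigma> (rc_map jY e) = e"
    by (rule vertex_chains_eqI [OF e additive_comp [OF add(3) additive_rc_map] additive_ident])
       (simp add: \<sigma>_def)
  ultimately show ?thesis using eq by (intro bexI [of _ "\<kappa> d"]) auto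
qed

text \<open>
  Lifts \<open>u\<close> and \<open>v\<close> of the two parts of a cycle have boundaries that come from one vertex chain \<open>b\<close>
  of \<open>A\<close>.  Boundaries have augmentation \<open>0\<close>, and \<open>A\<close> is connected, so \<open>b\<close> bounds a chain of edges of
  \<open>A\<close>; subtracting its images turns both lifts into cycles.
\<close>

lemma cycles_onto:
  assumes conn: "zigzag_connected A" and c: "c \<in> edge_cycles P"
  shows "\<exists>u \<in> edge_cycles X. \<exists>v \<in> edge_cycles Y. c = rc_map jX u - rc_map jY v"
proof -
  obtain u v where uv: "u \<in> edge_chains X" "v \<in> edge_chains Y" "c = rc_map jX u - rc_map jY v"
    using lift_edge_chain [of c] c unfolding edge_cycles_def by blast
  have "rc_map jX (rc_boundary u) = rc_map jY (rc_boundary v)"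
    using c uv by (simp add: edge_cycles_def rc_boundary_simps rc_map_boundary [OF uv(1)] rc_map_boundary [OF uv(2)])
  then obtain b where b: "b \<in> vertex_chains (pverts A)" "rc_map \<phi>X b = rc_boundary u"
    "rc_map \<phi>Y b = rc_boundary v"
    using boundary_lives_on_A rc_boundary_edge_chain loopX loopY uv by metis
  obtain w where w: "w \<in> edge_chains A" "rc_boundary w = b"
  proof (cases "pverts A = {}")
    case True
    then have "b = 0" using b by (simp add: vertex_chains_def)
    then show ?thesis
      using that [of 0] by (simp add: rc_boundary_simps add_closedD(1) [OF add_closed_chains(2)])
  next
    case False
    then obtain a where a: "a \<in> pverts A" by blast
    have "rc_map (\<lambda>_. a) b = rc_map (\<lambda>_. a) (rc_map \<phi>X b)"
      by (rule vertex_chains_eqI [OF b(1)]) (auto intro!: additive_chain_maps)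
    also have "\<dots> = rc_boundary (rc_map (\<lambda>_. a) u)"
      by (simp add: b rc_map_boundary [OF uv(1)])
    also have "rc_map (\<lambda>_. a) u = 0"
      by (rule edge_chains_eqI [OF uv(1)]) (auto intro!: additive_chain_maps)
    finally have "rc_map (\<lambda>_. a) b = 0" by (simp add: rc_boundary_simps)
    then show ?thesis
      using connected_vertex_chain [OF loopA conn a b(1)] that by auto
  qed
  have "u - rc_map \<phi>X w \<in> edge_cycles X" "v - rc_map \<phi>Y w \<in> edge_cycles Y"
    using uv b w rc_map_edge_chain [OF \<phi>X w(1)] rc_map_edge_chain [OF \<phi>Y w(1)]
    by (simp_all add: edge_cycles_def rc_boundary_simps rc_map_boundary [OF w(1)]
        add_closedD(2) [OF add_closed_chains(2)])
  moreover have "c = rc_map jX (u - rc_map \<phi>X w) - rc_map jY (v - rc_map \<phi>Y w)"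
    by (simp add: uv rc_map_simps glue_edge [OF w(1)])
  ultimately show ?thesis by blast
qed

end

section \<open>The pushout square\<close>

text \<open>
  The equivalence classes are told apart by the invariant that sends \<open>x\<close> outside \<open>A\<close> to itself and
  everything else to its representative in \<open>Y\<close>, which is unique because \<open>f\<close> is injective on \<open>A\<close>.
\<close>

lemma pushout_classes:
  fixes A :: "'a pair_pre_digraph" and f :: "'a \<Rightarrow> 'b" and g :: "'a \<Rightarrow> 'c"
  assumes inj: "inj_on f (pverts A)"
  shows "pushout_inr A f g y = pushout_inr A f g y' \<Longrightarrow> y = y'"
    and "pushout_inl A f g x = pushout_inr A f g y \<Longrightarrow> \<exists>a\<in>pverts A. x = f a \<and> y = g a"
    and "x \<notin> f ` pverts A \<Longrightarrow> pushout_inl A f g x = pushout_inl A f g x' \<Longrightarrow> x = x'"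
proof -
  define h where "h x = (if x \<in> f ` pverts A then Inr (g (inv_into (pverts A) f x)) else Inl x)" for x
  have "h (f a) = Inr (g a)" if "a \<in> pverts A" for a
    using that inj by (simp add: h_def)
  then have inv: "case_sum h Inr u = case_sum h Inr v"
    if "pushout_rel A f g `` {u} = pushout_rel A f g `` {v}" for u v
    using eq_equiv_class [OF that equiv_pushout_rel] pushout_rel_invariant [of u v A f g h Inr] by blast
  show "y = y'" if "pushout_inr A f g y = pushout_inr A f g y'"
    using inv [of "Inr y" "Inr y'"] that by (simp add: pushout_inr_def)
  show "\<exists>a\<in>pverts A. x = f a \<and> y = g a" if "pushout_inl A f g x = pushout_inr A f g y"
  proof -
    have "h x = Inr y"
      using inv [of "Inl x" "Inr y"] that by (simp add: pushout_inr_def pushout_inl_def)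
    then have "x \<in> f ` pverts A" "g (inv_into (pverts A) f x) = y"
      by (auto simp: h_def split: if_splits)
    then show ?thesis by (metis f_inv_into_f inv_into_into)
  qed
  show "x = x'" if "x \<notin> f ` pverts A" "pushout_inl A f g x = pushout_inl A f g x'"
    using inv [of "Inl x" "Inl x'"] that by (auto simp: pushout_inl_def h_def split: if_splits)
qed

text \<open>
  Both cases of the definition, \<open>d(a, x) \<le> r\<close> and \<open>d(a, x) > r\<close>, give a bound by \<open>s\<close> on the length of
  the detour through \<open>\<pi> x\<close>, since \<open>r \<le> s\<close> and \<open>d(a, x) \<le> s\<close>.
\<close>

lemma r_cofibration_retraction:
  assumes cof: "r_cofibration r A X i" and "r \<le> s"
  shows "\<exists>\<pi>. \<forall>a x m. a \<in> pverts A \<longrightarrow> x \<in> pverts X \<longrightarrow> ddist X (i a) x = enat m \<longrightarrow> m \<le> s \<longrightarrow>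
       \<pi> x \<in> pverts A \<and> (\<exists>k l. ddist X (i a) (i (\<pi> x)) = enat k \<and>
         ddist X (i (\<pi> x)) x = enat l \<and> k \<le> m \<and> k + l \<le> s)"
proof -
  let ?AX = "i ` pverts A"
  obtain \<pi> where \<pi>: "\<pi> ` reach X ?AX \<subseteq> ?AX"
    and d: "\<forall>a\<in>?AX. \<forall>x\<in>reach X ?AX. ddist X a (\<pi> x) \<le> ddist X a x \<and>
      (ddist X a x \<le> enat r \<longrightarrow> ddist X a (\<pi> x) + ddist X (\<pi> x) x \<le> enat r) \<and>
      (ddist X a x > enat r \<longrightarrow> ddist X a (\<pi> x) + ddist X (\<pi> x) x = ddist X a x)"
    using cof unfolding r_cofibration_def by (elim conjE exE) (rule that)
  show ?thesis
  proof (intro exI [of _ "\<lambda>x. inv_into (pverts A) i (\<pi> x)"] allI impI)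
    fix a x m
    assume a: "a \<in> pverts A" and x: "x \<in> pverts X" and m: "ddist X (i a) x = enat m" "m \<le> s"
    have rx: "x \<in> reach X ?AX" using a x m by (auto simp: reach_def)
    then have "\<pi> x \<in> ?AX" using \<pi> by blast
    then have inA: "inv_into (pverts A) i (\<pi> x) \<in> pverts A" and eq: "i (inv_into (pverts A) i (\<pi> x)) = \<pi> x"
      by (simp_all add: inv_into_into f_inv_into_f)
    note D = bspec [OF bspec [OF d imageI [OF a]] rx]
    have le: "ddist X (i a) (\<pi> x) \<le> enat m" using D m(1) by simp
    have sum: "ddist X (i a) (\<pi> x) + ddist X (\<pi> x) x \<le> enat s"
    proof (cases "m \<le> r")
      case True
      then have "ddist X (i a) (\<pi> x) + ddist X (\<pi> x) x \<le> enat r" using D m(1) by simp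
      also have "enat r \<le> enat s" using assms(2) by simp
      finally show ?thesis .
    next
      case False
      then show ?thesis using D m by simp
    qed
    from sum obtain k l where "ddist X (i a) (\<pi> x) = enat k" "ddist X (\<pi> x) x = enat l"
      by (cases "ddist X (i a) (\<pi> x)"; cases "ddist X (\<pi> x) x") auto
    then show "inv_into (pverts A) i (\<pi> x) \<in> pverts A \<and>
        (\<exists>k l. ddist X (i a) (i (inv_into (pverts A) i (\<pi> x))) = enat k \<and>
         ddist X (i (inv_into (pverts A) i (\<pi> x))) x = enat l \<and> k \<le> m \<and> k + l \<le> s)"
      using inA le sum unfolding eq by simp
  qed
qed

lemma cofibration_gluing_pushout:
  assumes A: "pair_loopfree_digraph A" and X: "pair_loopfree_digraph X" and Y: "pair_loopfree_digraph Y"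
    and f: "digraph_map A X f" and g: "digraph_map A Y g"
    and cof: "r_cofibration r A X f" and s: "r \<le> s" "1 \<le> s"
  shows "\<exists>\<pi>. cofibration_gluing A X Y (pushout A X Y f g) f g (pushout_inl A f g) (pushout_inr A f g) \<pi> s"
proof -
  interpret X: pair_loopfree_digraph X by (rule X)
  have ind: "induced_inclusion A X f" using cof by (simp add: r_cofibration_def)
  then have inj: "inj_on f (pverts A)" by (simp add: induced_inclusion_def)
  obtain \<pi> where \<pi>: "\<forall>a x m. a \<in> pverts A \<longrightarrow> x \<in> pverts X \<longrightarrow> ddist X (f a) x = enat m \<longrightarrow> m \<le> s \<longrightarrow>
       \<pi> x \<in> pverts A \<and> (\<exists>k l. ddist X (f a) (f (\<pi> x)) = enat k \<and>
         ddist X (f (\<pi> x)) x = enat l \<and> k \<le> m \<and> k + l \<le> s)"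
    using r_cofibration_retraction [OF cof s(1)] by (elim exE) (rule that)
  have far: "\<forall>x \<in> pverts X - f ` pverts A. \<forall>a \<in> f ` pverts A. ddist X x a = \<infinity>"
    using cof by (simp add: r_cofibration_def)
  have no_return: "x \<in> f ` pverts A" if "(x, x') \<in> parcs X" "x' \<in> f ` pverts A" for x x'
  proof (rule ccontr)
    assume "x \<notin> f ` pverts A"
    then have "ddist X x x' = \<infinity>"
      using X.in_arcsD1 [OF that(1)] that(2) by (intro bspec [OF bspec [OF far]]) simp_all
    then show False using ddist_eq_1_iff [OF X, of x x'] that by simp
  qed
  have "cofibration_gluing A X Y (pushout A X Y f g) f g (pushout_inl A f g) (pushout_inr A f g) \<pi> s"
  proof (rule cofibration_gluing.intro)
    show "p \<noteq> q \<and>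
       ((\<exists>x x'. (x, x') \<in> parcs X \<and> p = pushout_inl A f g x \<and> q = pushout_inl A f g x') \<or>
        (\<exists>y y'. (y, y') \<in> parcs Y \<and> p = pushout_inr A f g y \<and> q = pushout_inr A f g y'))"
      if "(p, q) \<in> parcs (pushout A X Y f g)" for p q
      using that by (auto simp: pushout_def)
  qed (fact A X Y f g ind no_return \<pi> [rule_format] s(2) pushout_classes [OF inj] pushout_loopfree [OF X Y]
      pushout_cocone [OF X Y] | simp add: pverts_pushout)+
  then show ?thesis by blast
qed

theorem corollary5p23:
  fixes A :: "'a pair_pre_digraph" and X :: "'b pair_pre_digraph" and Y :: "'c pair_pre_digraph"
    and \<phi>X :: "'a \<Rightarrow> 'b" and \<phi>Y :: "'a \<Rightarrow> 'c" and r s :: nat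
  defines "P \<equiv> pushout A X Y \<phi>X \<phi>Y"
    and "jX \<equiv> pushout_inl A \<phi>X \<phi>Y"
    and "jY \<equiv> pushout_inr A \<phi>X \<phi>Y"
  assumes "pair_loopfree_digraph A" "pair_loopfree_digraph X" "pair_loopfree_digraph Y"
    and "digraph_map A X \<phi>X" and "digraph_map A Y \<phi>Y"
    and "r_cofibration r A X \<phi>X" and "r \<ge> 2"
    and "zigzag_connected A" "zigzag_connected X" "zigzag_connected Y"
    and "r \<le> s"
  defines "\<alpha> \<equiv> (\<lambda>c. (mpss_map (int s) 1 0 X \<phi>X c, mpss_map (int s) 1 0 Y \<phi>Y c))"
    and "\<beta> \<equiv> (\<lambda>(u, v). mpss_map (int s) 1 0 P jX u
                  \<otimes>\<^bsub>mpss (int s) 1 0 P\<^esub> inv\<^bsub>mpss (int s) 1 0 P\<^esub> mpss_map (int s) 1 0 P jY v)"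
  shows "exact_at (mpss (int s) 1 0 A) \<alpha> (mpss (int s) 1 0 X \<times>\<times> mpss (int s) 1 0 Y) \<beta>
           (mpss (int s) 1 0 P) \<and>
         exact_at (mpss (int s) 1 0 X \<times>\<times> mpss (int s) 1 0 Y) \<beta> (mpss (int s) 1 0 P) (\<lambda>_. ())
           (singleton_group ())"
proof -
  have two_le: "2 \<le> s" and one_le: "1 \<le> s" using \<open>r \<ge> 2\<close> \<open>r \<le> s\<close> by auto
  obtain \<pi> where "cofibration_gluing A X Y P \<phi>X \<phi>Y jX jY \<pi> s"
    unfolding P_def jX_def jY_def
    using cofibration_gluing_pushout [OF assms(4-9) \<open>r \<le> s\<close> one_le] by blast
  then interpret cofibration_gluing A X Y P \<phi>X \<phi>Y jX jY \<pi> s .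
  note page = mpss_1_0 [OF _ two_le] and induced_map = mpss_map_1_0 [OF _ two_le]
  note quotient = add_group_Mod [OF add_closed_chains(3) add_closed_walk_null walk_null_subset_cycles]
  show ?thesis
    unfolding page [OF loopA] page [OF loopX] page [OF loopY] page [OF loopP]
  proof (rule mayer_vietoris_quotients [where f = "rc_map \<phi>X" and h = "rc_map \<phi>Y"
        and j = "rc_map jX" and k = "rc_map jY"])
    show "\<alpha> (add_coset (walk_null s A) w) =
        (add_coset (walk_null s X) (rc_map \<phi>X w), add_coset (walk_null s Y) (rc_map \<phi>Y w))" for w
      by (simp add: \<alpha>_def induced_map [OF loopX \<phi>X] induced_map [OF loopY \<phi>Y])
    show "\<beta> (add_coset (walk_null s X) u, add_coset (walk_null s Y) v) =
        add_coset (walk_null s P) (rc_map jX u - rc_map jY v)"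
      if "u \<in> edge_cycles X" "v \<in> edge_cycles Y" for u v
      using rc_map_cycle [OF jX that(1)] rc_map_cycle [OF jY that(2)]
      by (simp add: add_closedD(3) [OF add_closed_chains(3)] \<beta>_def induced_map [OF loopP jX] induced_map [OF loopP jY] page [OF loopP] quotient
          del: mult_FactGroup)
    show "rc_map jX (rc_map \<phi>X w) = rc_map jY (rc_map \<phi>Y w)" if "w \<in> edge_cycles A" for w
      using that glue_edge by (simp add: edge_cycles_def)
    show "\<exists>w\<in>edge_cycles A. u - rc_map \<phi>X w \<in> walk_null s X \<and> v - rc_map \<phi>Y w \<in> walk_null s Y"
      if "u \<in> edge_cycles X" "v \<in> edge_cycles Y" "rc_map jX u - rc_map jY v \<in> walk_null s P" for u v
      using that by (rule exact_middle)
    show "\<exists>u\<in>edge_cycles X. \<exists>v\<in>edge_cycles Y. c = rc_map jX u - rc_map jY v"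
      if "c \<in> edge_cycles P" for c
      using \<open>zigzag_connected A\<close> that by (rule cycles_onto)
  qed (auto intro: add_closed_chains(3) add_closed_walk_null subsetD [OF walk_null_subset_cycles]
      additive_rc_map rc_map_cycle \<phi>X \<phi>Y jX jY)
qed

end
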